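(* For every integer $n\ge 1$, $$\int |u_n|^2\, d\nu_0=\frac{1}{n+1}.$$
   Context: For a Riemann surface $S$, $\mathrm{Loop}(S)$ is the set of compact subsets of $S$ homeomorphic to the circle $S^1$, with the Vietoris topology. A family of positive Borel measures $\mu_S$ on $\mathrm{Loop}(S)$, one for each Riemann surface $S$, satisfies conformal restriction if for each conformal embedding $S_1\to S_2$ the restriction of $\mu_{S_2}$ to $\mathrm{Loop}(S_1)$ equals $\mu_{S_1}$. It is nontrivial if for some $0<\alpha<A$ the set of loops $\gamma\in \mathrm{Loop}(\{0<|z|<A\})\setminus \mathrm{Loop}(\{|z|<\alpha\})$ surrounding $0$ has finite positive measure. By a theorem of Werner such a nontrivial family exists and is unique up to a positive constant. $\mathrm{Loop}^1(\mathbb C\setminus\{0\})$ is the set of loops in $\mathbb C\setminus\{0\}$ which surround $0$, and $\mu_0$ is the restriction of Werner's measure to $\mathrm{Loop}^1(\mathbb C\setminus\{0\})$. Let $\Delta=\{|z|<1\}$ and $\Delta^*=\{|z|>1\}\cup\{\infty\}$. For $\gamma\in\mathrm{Loop}^1(\mathbb C\setminus\{0\})$ let $U_+\ni 0$ and $U_-\ni\infty$ be the two components of $(\mathbb C\cup\{\infty\})\setminus\gamma$. Let $\phi_+:(\Delta,0)\to(U_+,0)$ be the conformal isomorphism normalized by $\phi_+(z)=\rho_0 u(z)$, $u(z)=z(1+\sum_{n\ge1}u_nz^n)$, $\rho_0>0$, and $\phi_-:(\Delta^*,\infty)\to(U_-,\infty)$ the conformal isomorphism normalized by $\phi_-(z)=\rho_\infty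 z(1+\sum_{n\ge1}b_nz^{-n})$, $\rho_\infty>0$. The map $\gamma\mapsto(u,\rho_\infty)$ is injective, and under it $\mu_0$ takes the form $d\mu_0=d\nu_0(u)\times \frac{d\rho_\infty}{\rho_\infty}$, where $\nu_0$ is a finite measure on the set of $u$; the multiplicative constant in Werner's measure is fixed so that $\nu_0$ is a probability measure. *)

theory Defs
  imports "HOL-Complex_Analysis.Complex_Analysis" "HOL-Probability.Probability"
begin

section \<open>Riemann surfaces\<close>

text \<open>
  A Riemann surface is presented by its underlying space together with a holomorphic atlas. The
  atlas need not be maximal: surfaces that differ only in the choice of a compatible atlas are
  related by the identity map, which is a conformal embedding in both directions.
  A chart is a pair of its domain and a map whose values off that domain are irrelevant.
\<close>

record 'a surface =
  surf_top :: "'a topology"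
  charts :: "('a set \<times> ('a \<Rightarrow> complex)) set"

definition riemann_surface :: "'a surface \<Rightarrow> bool" where
  "riemann_surface S \<longleftrightarrow>
     topspace (surf_top S) \<noteq> {} \<and> connected_space (surf_top S) \<and> Hausdorff_space (surf_top S) \<and>
     (\<Union>(V, \<phi>)\<in>charts S. V) = topspace (surf_top S) \<and>
     (\<forall>(V, \<phi>)\<in>charts S. openin (surf_top S) V \<and> open (\<phi> ` V) \<and>
        homeomorphic_map (subtopology (surf_top S) V) (top_of_set (\<phi> ` V)) \<phi>) \<and>
     (\<forall>(V, \<phi>)\<in>charts S. \<forall>(W, \<psi>)\<in>charts S.
        (\<psi> \<circ> inv_into V \<phi>) holomorphic_on \<phi> ` (V \<inter> W))"

text \<open>The image of an injective holomorphic map is automatically open, by the open mapping theorem.\<close>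

definition conformal_embedding :: "'a surface \<Rightarrow> 'b surface \<Rightarrow> ('a \<Rightarrow> 'b) \<Rightarrow> bool" where
  "conformal_embedding S T f \<longleftrightarrow>
     continuous_map (surf_top S) (surf_top T) f \<and> inj_on f (topspace (surf_top S)) \<and>
     (\<forall>(V, \<phi>)\<in>charts S. \<forall>(W, \<psi>)\<in>charts T.
        (\<psi> \<circ> f \<circ> inv_into V \<phi>) holomorphic_on \<phi> ` (V \<inter> f -` W))"

definition plane_surface :: "complex set \<Rightarrow> complex surface" where
  "plane_surface D = \<lparr>surf_top = top_of_set D, charts = {(D, \<lambda>z. z)}\<rparr>"


section \<open>The space of loops\<close>

definition Loop :: "'a topology \<Rightarrow> 'a set set" where
  "Loop X = {\<gamma>. compactin X \<gamma> \<and>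
     subtopology X \<gamma> homeomorphic_space top_of_set (sphere (0 :: complex) 1)}"

definition vietoris :: "'a topology \<Rightarrow> 'a set topology" where
  "vietoris X = topology_generated_by
     ({{\<gamma> \<in> Loop X. \<gamma> \<subseteq> U} | U. openin X U} \<union> {{\<gamma> \<in> Loop X. \<gamma> \<inter> U \<noteq> {}} | U. openin X U})"

definition borel_of :: "'a topology \<Rightarrow> 'a measure" where
  "borel_of X = sigma (topspace X) {U. openin X U}"


section \<open>Families satisfying conformal restriction\<close>

text \<open>
  HOL has no family ranging over surfaces of all types at once, so points of surfaces are taken
  from the type \<^typ>\<open>complex\<close>. The topology and the atlas of a surface are arbitrary and unrelated
  to those of the plane, and a Riemann surface has the cardinality of the continuum; hence every
  Riemann surface, compact ones included, is isomorphic to one of these.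
\<close>

definition conformal_restriction :: "(complex surface \<Rightarrow> complex set measure) \<Rightarrow> bool" where
  "conformal_restriction \<mu> \<longleftrightarrow>
     (\<forall>S. riemann_surface S \<longrightarrow> sets (\<mu> S) = sets (borel_of (vietoris (surf_top S)))) \<and>
     (\<forall>S T f. riemann_surface S \<longrightarrow> riemann_surface T \<longrightarrow> conformal_embedding S T f \<longrightarrow>
        (\<forall>E\<in>sets (\<mu> S). emeasure (\<mu> T) ((\<lambda>\<gamma>. f ` \<gamma>) ` E) = emeasure (\<mu> S) E))"

definition surrounds_zero :: "complex set \<Rightarrow> bool" where
  "surrounds_zero \<gamma> \<longleftrightarrow> 0 \<in> inside \<gamma>"

definition nontrivial :: "(complex surface \<Rightarrow> complex set measure) \<Rightarrow> bool" where
  "nontrivial \<mu> \<longleftrightarrow> (\<exists>\<alpha> A. 0 < \<alpha> \<and> \<alpha> < A \<and>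
     (let m = emeasure (\<mu> (plane_surface {z. 0 < norm z \<and> norm z < A}))
                {\<gamma> \<in> Loop (top_of_set {z. 0 < norm z \<and> norm z < A})
                      - Loop (top_of_set {z. norm z < \<alpha>}). surrounds_zero \<gamma>}
      in 0 < m \<and> m < \<infinity>))"

definition werner_family :: "(complex surface \<Rightarrow> complex set measure) \<Rightarrow> bool" where
  "werner_family \<mu> \<longleftrightarrow> conformal_restriction \<mu> \<and> nontrivial \<mu>"

definition Loop1 :: "complex set set" where
  "Loop1 = {\<gamma> \<in> Loop (top_of_set (- {0})). surrounds_zero \<gamma>}"

definition \<mu>\<^sub>0 :: "(complex surface \<Rightarrow> complex set measure) \<Rightarrow> complex set measure" where
  "\<mu>\<^sub>0 \<mu> = restrict_space (\<mu> (plane_surface (- {0}))) Loop1"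


section \<open>Uniformization of the two sides of a loop\<close>

definition conformal_iso :: "complex set \<Rightarrow> complex set \<Rightarrow> (complex \<Rightarrow> complex) \<Rightarrow> bool" where
  "conformal_iso D E f \<longleftrightarrow> f holomorphic_on D \<and> bij_betw f D E"

text \<open>
  The map \<open>u\<close> is a function on the open unit disc, with value \<^term>\<open>undefined\<close> elsewhere.
  The component of the complement of the loop containing 0 is the same in the plane and in the
  sphere, as the loop separates 0 from infinity.
\<close>

definition interior_map :: "complex set \<Rightarrow> real \<Rightarrow> (complex \<Rightarrow> complex) \<Rightarrow> bool" where
  "interior_map \<gamma> \<rho> u \<longleftrightarrow> 0 < \<rho> \<and> u \<in> extensional (ball 0 1) \<and> u 0 = 0 \<and> deriv u 0 = 1 \<and>
     conformal_iso (ball 0 1) (connected_component_set (- \<gamma>) 0) (\<lambda>z. of_real \<rho> * u z)"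

text \<open>
  The component of the sphere minus the loop that contains infinity is \<^term>\<open>outside \<gamma>\<close> together
  with infinity. The Laurent expansion makes \<open>\<phi>\<close> extend holomorphically to infinity, fixing it.
\<close>

definition exterior_map :: "complex set \<Rightarrow> real \<Rightarrow> (complex \<Rightarrow> complex) \<Rightarrow> bool" where
  "exterior_map \<gamma> \<rho> \<phi> \<longleftrightarrow> 0 < \<rho> \<and> conformal_iso {z. 1 < norm z} (outside \<gamma>) \<phi> \<and>
     (\<exists>b. \<forall>z. 1 < norm z \<longrightarrow>
        summable (\<lambda>n. b (Suc n) * inverse z ^ Suc n) \<and>
        \<phi> z = of_real \<rho> * z * (1 + (\<Sum>n. b (Suc n) * inverse z ^ Suc n)))"

definition loop_u :: "complex set \<Rightarrow> complex \<Rightarrow> complex" where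
  "loop_u \<gamma> = (THE u. \<exists>\<rho>. interior_map \<gamma> \<rho> u)"

definition loop_rho_inf :: "complex set \<Rightarrow> real" where
  "loop_rho_inf \<gamma> = (THE \<rho>. \<exists>\<phi>. exterior_map \<gamma> \<rho> \<phi>)"

text \<open>
  The functions \<open>u\<close> are normalized and univalent, so they form a normal family on which the
  topology of pointwise convergence (that of the function type) is the topology of locally
  uniform convergence.
\<close>

definition u_space :: "(complex \<Rightarrow> complex) measure" where
  "u_space = restrict_space borel (loop_u ` Loop1)"

text \<open>The coefficient of \<open>z\<^sup>n\<close> in \<open>u z / z\<close>, that is, of \<open>z ^ (n + 1)\<close> in \<open>u z\<close>.\<close>

definition u_coeff :: "nat \<Rightarrow> (complex \<Rightarrow> complex) \<Rightarrow> complex" where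
  "u_coeff n u = (deriv ^^ Suc n) u 0 / fact (Suc n)"

definition log_measure :: "real measure" where
  "log_measure = density lborel (\<lambda>\<rho>. indicator {0<..} \<rho> * ennreal (1 / \<rho>))"

definition is_\<nu>\<^sub>0 ::
  "(complex surface \<Rightarrow> complex set measure) \<Rightarrow> (complex \<Rightarrow> complex) measure \<Rightarrow> bool" where
  "is_\<nu>\<^sub>0 \<mu> \<nu> \<longleftrightarrow> sets \<nu> = sets u_space \<and>
     distr (\<mu>\<^sub>0 \<mu>) (u_space \<Otimes>\<^sub>M borel) (\<lambda>\<gamma>. (loop_u \<gamma>, loop_rho_inf \<gamma>)) = \<nu> \<Otimes>\<^sub>M log_measure"

end

theory Submission
  imports Defs
begin

text \<open>
  The proof is a mass transport argument. Put \<open>D(\<gamma>, x, r)\<close> for the hyperbolic disc of Euclidean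
  parameter \<open>r\<close> about a point \<open>x\<close> inside \<open>\<gamma>\<close>, and let every such \<open>x\<close> send the mass
  \<open>crad(\<gamma>, x)\<^sup>-\<^sup>2 dy\<close> to the points \<open>y\<close> of \<open>D(\<gamma>, x, r)\<close>, where \<open>crad\<close> is the conformal radius.
  Everything is translation invariant, and so is \<open>\<rho>\<^sub>\<infinity>\<close>; hence, averaged over the loops with
  \<open>1 \<le> \<rho>\<^sub>\<infinity> \<le> e\<close>, the mass sent by \<open>0\<close> equals the mass received by \<open>0\<close>. The former is the mean of
  \<open>\<integral>\<^sub>|\<^sub>z\<^sub>|\<^sub>\<le>\<^sub>r |u'(z)|\<^sup>2 dA = \<pi> \<Sum> (n + 1) |u\<^sub>n|\<^sup>2 r\<^sup>2\<^sup>n\<^sup>+\<^sup>2\<close>, the latter is the hyperbolic area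
  \<open>\<integral>\<^sub>|\<^sub>z\<^sub>|\<^sub>\<le>\<^sub>r (1 - |z|\<^sup>2)\<^sup>-\<^sup>2 dA = \<pi> \<Sum> r\<^sup>2\<^sup>n\<^sup>+\<^sup>2\<close>. Compare the coefficients of \<open>r\<close>.
\<close>

section \<open>Area integrals in the plane\<close>

text \<open>Two obstacles shape the averaging. First, \<open>\<mu>\<^sub>0\<close> has infinite
  mass. Cutting to \<open>loop_rho_inf\<close> in {1..exp 1} cures this and respects translations,
  because the leading coefficient of the exterior map ignores them, whereas \<open>loop_rho\<close>
  changes. The window has mass 1 for d\<rho>/\<rho>, so by the product form the law of
  \<open>loop_u\<close> under the cut measure is exactly \<open>\<nu>\<close>. Second, a translate
  of a loop around 0 need not surround 0. Mass is exchanged between 0 and d only inside a common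
  loop, and such a loop lives in the plane punctured at both points, where conformal restriction can
  be used twice. The weight crad^-2 serves both sides: at 0 it cancels the scale of the Riemann map,
  so the mass sent depends on u alone, and at a varying point it produces hyperbolic area, so the
  mass received is the same for every loop and no knowledge of \<open>\<nu>\<close> is required to
  average it. Hyperbolic distance is symmetric, so the points to which 0 sends and those from which
  it receives form the same set, the image of \<open>cball 0 r\<close> under the Riemann map. All
  terms are nonnegative, so integrals and sums may be exchanged in \<open>ennreal\<close> before any
  moment is known to be finite.\<close>

lemma lborel_complex_eq_distr:
  "(lborel :: complex measure) = distr (lborel :: (real^2) measure) borel (\<lambda>v. Complex (v$1) (v$2))"
proof (rule lborel_eqI)
  have cont: "continuous_on UNIV (\<lambda>v::real^2. Complex (v$1) (v$2))"
    unfolding complex_eq_iff by (auto simp: Complex_eq intro!: continuous_intros)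
  then have [measurable]: "(\<lambda>v::real^2. Complex (v$1) (v$2)) \<in> borel \<rightarrow>\<^sub>M borel"
    by (rule borel_measurable_continuous_onI)
  fix l u :: complex
  assume le: "\<And>b. b \<in> Basis \<Longrightarrow> l \<bullet> b \<le> u \<bullet> b"
  have le': "Re l \<le> Re u" "Im l \<le> Im u"
    using le[of 1] le[of \<i>] by (auto simp: Basis_complex_def)
  define L :: "real^2" where "L = vector [Re l, Im l]"
  define U :: "real^2" where "U = vector [Re u, Im u]"
  have eq: "(\<lambda>v::real^2. Complex (v$1) (v$2)) -` box l u = box L U"
    by (auto simp: box_def Basis_complex_def Basis_vec_def L_def U_def inner_axis forall_2)
  have B: "(Basis :: (real^2) set) = {axis 1 1, axis 2 1}"
    by (auto simp: Basis_vec_def UNIV_2)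
  have prod: "(\<Prod>b\<in>(Basis::(real^2) set). (U - L) \<bullet> b) = (Re u - Re l) * (Im u - Im l)"
  proof -
    have "axis 1 1 \<noteq> (axis 2 1 :: real^2)" by (simp add: axis_eq_axis)
    then show ?thesis
      unfolding B by (simp add: L_def U_def inner_axis)
  qed
  have "emeasure (distr lborel borel (\<lambda>v::real^2. Complex (v$1) (v$2))) (box l u) = emeasure lborel (box L U)"
    by (simp add: emeasure_distr eq)
  also have "\<dots> = (\<Prod>b\<in>(Basis::(real^2) set). (U - L) \<bullet> b)"
    by (rule emeasure_lborel_box) (auto simp: B L_def U_def inner_axis le')
  also have "\<dots> = (\<Prod>b\<in>(Basis::complex set). (u - l) \<bullet> b)"
    by (simp only: prod) (simp add: Basis_complex_def)
  finally show "emeasure (distr lborel borel (\<lambda>v::real^2. Complex (v$1) (v$2))) (box l u) = (\<Prod>b\<in>Basis. (u - l) \<bullet> b)" .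
qed simp

text \<open>Multiplication by w, seen on real^2, has determinant |w|^2, so the real change of
  variables formula has Jacobian |\<phi>'|^2. Intersecting with an arbitrary Borel set A yields an
  equality of measures rather than of total masses, which is what the passage to integrals
  uses.\<close>

lemma emeasure_holomorphic_image:
  fixes \<phi> :: "complex \<Rightarrow> complex"
  assumes S: "compact S" "S \<subseteq> T" "open T" and hol: "\<phi> holomorphic_on T" and inj: "inj_on \<phi> S"
    and A[measurable]: "A \<in> sets borel"
  shows "emeasure lborel (\<phi> ` S \<inter> A) =
    (\<integral>\<^sup>+z. ennreal ((cmod (deriv \<phi> z))\<^sup>2) * indicator (S \<inter> \<phi> -` A) z \<partial>lborel)"
proof -
  define e :: "real^2 \<Rightarrow> complex" where "e = (\<lambda>v. Complex (v$1) (v$2))"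
  define e' :: "complex \<Rightarrow> real^2" where "e' = (\<lambda>z. vector [Re z, Im z])"
  have ee'[simp]: "e (e' z) = z" for z by (simp add: e_def e'_def)
  have e'e[simp]: "e' (e v) = v" for v by (simp add: e_def e'_def vec_eq_iff forall_2)
  have lin_e: "linear e" by (auto intro!: linearI simp: e_def complex_eq_iff)
  have lin_e': "linear e'" by (auto intro!: linearI simp: e'_def vec_eq_iff forall_2)
  have ce: "continuous_on X e" "continuous_on Y e'" for X Y
    using lin_e lin_e' by (auto simp: linear_continuous_on linear_conv_bounded_linear)
  have [measurable]: "e \<in> borel \<rightarrow>\<^sub>M borel" "e' \<in> borel \<rightarrow>\<^sub>M borel"
    using ce by (auto intro: borel_measurable_continuous_onI)
  have D: "distr lborel borel e = lborel"
    using lborel_complex_eq_distr by (simp add: e_def)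
  have cphi: "continuous_on S \<phi>"
    using hol S holomorphic_on_imp_continuous_on continuous_on_subset by blast
  have cd: "continuous_on S (deriv \<phi>)"
    using hol S holomorphic_deriv holomorphic_on_imp_continuous_on continuous_on_subset by blast
  define E where "E = S \<inter> \<phi> -` A"
  have Sb[measurable]: "S \<in> sets borel" by (rule borel_compact[OF S(1)])
  have Eb[measurable]: "E \<in> sets borel"
  proof -
    have "\<phi> \<in> borel_measurable (restrict_space borel S)"
      using cphi by (rule borel_measurable_continuous_on_restrict)
    then have "\<phi> -` A \<inter> space (restrict_space borel S) \<in> sets (restrict_space borel S)"
      by (rule measurable_sets) (simp add: A)
    then show ?thesis
      by (auto simp: E_def sets_restrict_space space_restrict_space Int_commute)
  qed
  have phiS: "compact (\<phi> ` S)" using S cphi compact_continuous_image by blast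
  have phiE: "\<phi> ` E = \<phi> ` S \<inter> A" by (auto simp: E_def)
  have phiEb[measurable]: "\<phi> ` E \<in> sets borel"
    unfolding phiE by (intro sets.Int borel_compact phiS A)
  define d where "d z = (cmod (deriv \<phi> z))\<^sup>2 * indicator E z" for z
  have dmeas[measurable]: "d \<in> borel_measurable borel"
  proof -
    have "continuous_on S (\<lambda>z. (cmod (deriv \<phi> z))\<^sup>2)" by (intro continuous_intros cd)
    then have "(\<lambda>z. indicator S z *\<^sub>R (cmod (deriv \<phi> z))\<^sup>2) \<in> borel_measurable borel"
      by (intro borel_measurable_continuous_on_indicator) auto
    then have "(\<lambda>z. indicator E z * (indicator S z *\<^sub>R (cmod (deriv \<phi> z))\<^sup>2)) \<in> borel_measurable borel"
      by measurable
    also have "(\<lambda>z. indicator E z * (indicator S z *\<^sub>R (cmod (deriv \<phi> z))\<^sup>2)) = d"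
      by (auto simp: d_def E_def indicator_def)
    finally show ?thesis .
  qed
  obtain C where C: "\<And>z. z \<in> S \<Longrightarrow> cmod (deriv \<phi> z) \<le> C" "C > 0"
  proof -
    have "bounded (deriv \<phi> ` S)" using cd S compact_continuous_image compact_imp_bounded by blast
    then show ?thesis using that by (auto simp: bounded_pos)
  qed
  let ?S = "e' ` E"
  let ?f = "e' \<circ> \<phi> \<circ> e"
  have S'eq: "?S = e -` E" by (auto intro: image_eqI[where x="e _"])
  have Sbor: "?S \<in> sets borel" unfolding S'eq using measurable_sets[OF \<open>e \<in> borel \<rightarrow>\<^sub>M borel\<close> Eb] by simp
  have fS: "?f ` ?S = e -` (\<phi> ` E)"
    by (auto simp: image_iff) (metis ee' e'e)
  have der: "(?f has_derivative (e' \<circ> (*) (deriv \<phi> (e v)) \<circ> e)) (at v within ?S)" if "v \<in> ?S" for v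
  proof -
    have "e v \<in> T" using that S by (auto simp: S'eq E_def)
    then have "(\<phi> has_field_derivative deriv \<phi> (e v)) (at (e v))"
      using hol S holomorphic_derivI by blast
    then have 1: "(\<phi> has_derivative (*) (deriv \<phi> (e v))) (at (e v))"
      by (simp add: has_field_derivative_def)
    have 2: "(e has_derivative e) (at v)" "\<And>z. (e' has_derivative e') (at z)"
      using lin_e lin_e' by (simp_all add: linear_imp_has_derivative)
    have "(?f has_derivative (e' \<circ> (*) (deriv \<phi> (e v)) \<circ> e)) (at v)"
      using diff_chain_at[OF diff_chain_at[OF 2(1) 1] 2(2)] by (simp add: comp_assoc)
    then show ?thesis by (rule has_derivative_at_withinI)
  qed
  have det: "\<bar>det (matrix (e' \<circ> (*) w \<circ> e))\<bar> = (cmod w)\<^sup>2" for w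
  proof -
    have "det (matrix (e' \<circ> (*) w \<circ> e)) = (cmod w)\<^sup>2"
      unfolding det_2 matrix_def cmod_power2
      by (simp add: e'_def e_def axis_def power2_eq_square)
    then show ?thesis by simp
  qed
  have injf: "inj_on ?f ?S"
    using inj by (intro inj_onI) (auto simp: E_def inj_on_def, metis ee')
  have le: "(\<integral>\<^sup>+v. ennreal (d (e v)) \<partial>lborel) = (\<integral>\<^sup>+z. ennreal (d z) \<partial>lborel)"
    using nn_integral_distr[of e lborel borel "\<lambda>z. ennreal (d z)"] by (simp add: D)
  \<comment> \<open>The derivative is bounded on the compact S. Finiteness turns the Jacobian into
    an integrable function, as the gauge integral in the change of variables formula
    demands.\<close>
  have fin: "(\<integral>\<^sup>+z. ennreal (d z) \<partial>lborel) < \<infinity>"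
  proof -
    have "(\<integral>\<^sup>+z. ennreal (d z) \<partial>lborel) \<le> (\<integral>\<^sup>+z. ennreal (C^2) * indicator S z \<partial>lborel)"
      using C by (intro nn_integral_mono) (auto simp: d_def E_def indicator_def intro!: ennreal_leI power_mono)
    also have "\<dots> = ennreal (C^2) * emeasure lborel S" by (simp add: nn_integral_cmult_indicator)
    also have "\<dots> < \<infinity>" using emeasure_compact_finite[OF S(1)] by (simp add: ennreal_mult_less_top)
    finally show ?thesis .
  qed
  have dn: "d z \<ge> 0" for z by (simp add: d_def)
  have int: "integrable lborel (\<lambda>v. d (e v))"
    by (rule integrableI_nonneg) (use fin le dn in auto)
  then have "((\<lambda>v. d (e v)) has_integral integral\<^sup>L lborel (\<lambda>v. d (e v))) UNIV"
    by (rule has_integral_integral_lborel)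
  moreover have "(\<lambda>v. d (e v)) = (\<lambda>v. if v \<in> ?S then (cmod (deriv \<phi> (e v)))\<^sup>2 else 0)"
    by (auto simp: d_def S'eq indicator_def)
  ultimately have "((\<lambda>v. (cmod (deriv \<phi> (e v)))\<^sup>2) has_integral integral\<^sup>L lborel (\<lambda>v. d (e v))) ?S"
    by (simp only: has_integral_restrict_UNIV)
  then have *: "?f ` ?S \<in> lmeasurable" "measure lebesgue (?f ` ?S) = integral\<^sup>L lborel (\<lambda>v. d (e v))"
    using has_measure_differentiable_image[of ?S ?f "\<lambda>v. e' \<circ> (*) (deriv \<phi> (e v)) \<circ> e", OF _ der injf] Sbor
    by (auto simp: det)
  have "emeasure lborel (\<phi> ` E) = emeasure lborel (e -` (\<phi> ` E))"
    using emeasure_distr[of e lborel borel "\<phi> ` E"] by (simp add: D)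
  also have "\<dots> = emeasure lebesgue (?f ` ?S)"
    unfolding fS using measurable_sets[OF \<open>e \<in> borel \<rightarrow>\<^sub>M borel\<close> phiEb] by simp
  also have "\<dots> = ennreal (integral\<^sup>L lborel (\<lambda>v. d (e v)))"
    by (simp only: emeasure_eq_measure2[OF *(1)] *(2))
  also have "\<dots> = (\<integral>\<^sup>+v. ennreal (d (e v)) \<partial>lborel)"
    by (rule nn_integral_eq_integral[OF int, symmetric]) (simp add: dn)
  also have "\<dots> = (\<integral>\<^sup>+z. ennreal ((cmod (deriv \<phi> z))\<^sup>2) * indicator E z \<partial>lborel)"
    unfolding le by (intro nn_integral_cong) (simp add: d_def indicator_def)
  finally show ?thesis
    by (simp only: phiE flip: E_def)
qed

lemma nn_integral_holomorphic_image:
  fixes \<phi> :: "complex \<Rightarrow> complex" and g :: "complex \<Rightarrow> ennreal"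
  assumes S: "compact S" "S \<subseteq> T" "open T" and hol: "\<phi> holomorphic_on T" and inj: "inj_on \<phi> S"
    and g[measurable]: "g \<in> borel_measurable borel"
  shows "(\<integral>\<^sup>+x. g x * indicator (\<phi> ` S) x \<partial>lborel) =
    (\<integral>\<^sup>+z. g (\<phi> z) * ennreal ((cmod (deriv \<phi> z))\<^sup>2) * indicator S z \<partial>lborel)"
proof -
  have cphi: "continuous_on S \<phi>"
    using hol S holomorphic_on_imp_continuous_on continuous_on_subset by blast
  have cd: "continuous_on S (deriv \<phi>)"
    using hol S holomorphic_deriv holomorphic_on_imp_continuous_on continuous_on_subset by blast
  have Sb[measurable]: "S \<in> sets borel" by (rule borel_compact[OF S(1)])
  have [measurable]: "\<phi> ` S \<in> sets borel"
    by (rule borel_compact[OF compact_continuous_image[OF cphi S(1)]])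
  \<comment> \<open>\<phi> and its derivative are controlled on S only. Cutting off by the indicator
    makes both Borel on the whole plane, and the density \<open>d\<close> vanishes wherever \<phi>
    was altered.\<close>
  define \<phi>' where "\<phi>' z = indicator S z *\<^sub>R \<phi> z" for z
  define d where "d z = indicator S z *\<^sub>R (cmod (deriv \<phi> z))\<^sup>2" for z
  have [measurable]: "\<phi>' \<in> borel_measurable borel"
    unfolding \<phi>'_def[abs_def] using cphi by (intro borel_measurable_continuous_on_indicator) auto
  have [measurable]: "d \<in> borel_measurable borel"
    unfolding d_def[abs_def] by (intro borel_measurable_continuous_on_indicator continuous_intros cd) auto
  have eq: "density lborel (indicator (\<phi> ` S)) = distr (density lborel (\<lambda>z. ennreal (d z))) borel \<phi>'"
  proof (rule measure_eqI)
    fix A :: "complex set" assume "A \<in> sets (density lborel (indicator (\<phi> ` S)))"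
    then have [measurable]: "A \<in> sets borel" by simp
    have "emeasure (density lborel (indicator (\<phi> ` S))) A = emeasure lborel (\<phi> ` S \<inter> A)"
      by (simp add: emeasure_density flip: indicator_inter_arith)
    also have "\<dots> = (\<integral>\<^sup>+z. ennreal ((cmod (deriv \<phi> z))\<^sup>2) * indicator (S \<inter> \<phi> -` A) z \<partial>lborel)"
      by (rule emeasure_holomorphic_image[OF S hol inj]) simp
    also have "\<dots> = (\<integral>\<^sup>+z. ennreal (d z) * indicator (\<phi>' -` A) z \<partial>lborel)"
      by (intro nn_integral_cong) (auto simp: d_def \<phi>'_def indicator_def)
    also have "\<dots> = emeasure (distr (density lborel (\<lambda>z. ennreal (d z))) borel \<phi>') A"
      using measurable_sets[OF \<open>\<phi>' \<in> borel_measurable borel\<close> \<open>A \<in> sets borel\<close>]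
      by (simp add: emeasure_distr emeasure_density)
    finally show "emeasure (density lborel (indicator (\<phi> ` S))) A =
      emeasure (distr (density lborel (\<lambda>z. ennreal (d z))) borel \<phi>') A" .
  qed simp
  have "(\<integral>\<^sup>+x. g x * indicator (\<phi> ` S) x \<partial>lborel) = (\<integral>\<^sup>+x. g x \<partial>density lborel (indicator (\<phi> ` S)))"
    by (simp add: nn_integral_density mult.commute)
  also have "\<dots> = (\<integral>\<^sup>+z. ennreal (d z) * g (\<phi>' z) \<partial>lborel)"
    unfolding eq by (simp add: nn_integral_distr nn_integral_density)
  also have "\<dots> = (\<integral>\<^sup>+z. g (\<phi> z) * ennreal ((cmod (deriv \<phi> z))\<^sup>2) * indicator S z \<partial>lborel)"
    by (intro nn_integral_cong) (auto simp: d_def \<phi>'_def indicator_def mult.commute)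
  finally show ?thesis .
qed

section \<open>Radial integrals and Parseval's identity on discs\<close>

lemma nn_integral_radial_cball:
  fixes f :: "real \<Rightarrow> ennreal"
  assumes [measurable]: "f \<in> borel_measurable borel" and r: "0 \<le> r"
  shows "(\<integral>\<^sup>+z. f ((cmod z)\<^sup>2) * indicator (cball 0 r) z \<partial>lborel) =
    ennreal pi * (\<integral>\<^sup>+t. f t * indicator {0..r\<^sup>2} t \<partial>lborel)"
proof -
  \<comment> \<open>The disc |z|^2 <= a has area pi a, so the squared modulus carries area to pi
    times Lebesgue measure on the half line. Squaring is what makes this density constant.\<close>
  have eq: "distr lborel borel (\<lambda>z::complex. (cmod z)\<^sup>2) = density lborel (\<lambda>t. ennreal pi * indicator {0..} t)"
    (is "?M = ?N")
  proof (rule measure_eqI_generator_eq)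
    show "Int_stable (range (\<lambda>a::real. {..a}))" by (auto simp: Int_stable_def)
    show "sets ?M = sigma_sets UNIV (range atMost)" "sets ?N = sigma_sets UNIV (range atMost)"
      by (simp_all add: borel_eq_atMost)
    have M: "emeasure ?M {..a} = (if a < 0 then 0 else ennreal (pi * a))" for a
    proof (cases "a < 0")
      case True
      have "\<not> (cmod z)\<^sup>2 \<le> a" for z using True zero_le_power2[of "cmod z"] by linarith
      then have "(\<lambda>z. (cmod z)\<^sup>2) -` {..a} = {}" by auto
      then show ?thesis using True by (simp add: emeasure_distr)
    next
      case False
      then have "(\<lambda>z. (cmod z)\<^sup>2) -` {..a} = cball 0 (sqrt a)"
        by (auto simp: real_le_rsqrt) (metis norm_ge_zero real_sqrt_pow2 power_mono not_less)
      then show ?thesis using False by (simp add: emeasure_distr emeasure_cball unit_ball_vol_2 power2_eq_square)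
    qed
    have N: "emeasure ?N {..a} = (if a < 0 then 0 else ennreal (pi * a))" for a
    proof -
      have "emeasure ?N {..a} = (\<integral>\<^sup>+t. ennreal pi * indicator {0..a} t \<partial>lborel)"
        by (subst emeasure_density) (auto intro!: nn_integral_cong simp: indicator_def)
      then show ?thesis by (simp add: nn_integral_cmult_indicator ennreal_mult)
    qed
    show "emeasure ?M X = emeasure ?N X" if "X \<in> range atMost" for X
      using that by (auto simp: M N)
    show "range (\<lambda>n. {..real n}) \<subseteq> range atMost" by auto
    show "(\<Union>i. {..real i}) = UNIV" by (auto intro: real_arch_simple)
    show "emeasure ?M {..real i} \<noteq> \<infinity>" for i by (simp add: M)
  qed simp
  have "(\<integral>\<^sup>+z. f ((cmod z)\<^sup>2) * indicator (cball 0 r) z \<partial>lborel) =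
      (\<integral>\<^sup>+z. (\<lambda>t. f t * indicator {..r\<^sup>2} t) ((cmod z)\<^sup>2) \<partial>lborel)"
    using r by (intro nn_integral_cong) (auto simp: indicator_def power2_le_iff_abs_le)
  also have "\<dots> = (\<integral>\<^sup>+t. f t * indicator {..r\<^sup>2} t \<partial>?M)"
    by (simp add: nn_integral_distr)
  also have "\<dots> = (\<integral>\<^sup>+t. ennreal pi * (f t * indicator {0..r\<^sup>2} t) \<partial>lborel)"
    unfolding eq by (subst nn_integral_density) (auto intro!: nn_integral_cong simp: indicator_def)
  also have "\<dots> = ennreal pi * (\<integral>\<^sup>+t. f t * indicator {0..r\<^sup>2} t \<partial>lborel)"
    by (simp add: nn_integral_cmult)
  finally show ?thesis .
qed

lemma nn_integral_cball_norm_power: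
  assumes "0 \<le> r"
  shows "(\<integral>\<^sup>+z. ennreal ((cmod (z ^ k))\<^sup>2) * indicator (cball 0 r) z \<partial>lborel) =
    ennreal (pi * r ^ (2 * k + 2) / (real k + 1))"
proof -
  have "(\<integral>\<^sup>+z. ennreal ((cmod (z ^ k))\<^sup>2) * indicator (cball 0 r) z \<partial>lborel) =
      (\<integral>\<^sup>+z. (\<lambda>t. ennreal (t ^ k)) ((cmod z)\<^sup>2) * indicator (cball 0 r) z \<partial>lborel)"
    by (simp add: norm_power flip: power_mult) (simp add: mult.commute)
  also have "\<dots> = ennreal pi * (\<integral>\<^sup>+t. ennreal (t ^ k) * indicator {0..r\<^sup>2} t \<partial>lborel)"
    by (rule nn_integral_radial_cball) (use assms in auto)
  also have "(\<integral>\<^sup>+t. ennreal (t ^ k) * indicator {0..r\<^sup>2} t \<partial>lborel) =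
      ennreal ((r\<^sup>2) ^ Suc k / real (Suc k) - 0 ^ Suc k / real (Suc k))"
    by (rule nn_integral_FTC_Icc)
      (auto intro!: derivative_eq_intros simp del: power_Suc of_nat_Suc)
  moreover have "pi * ((r\<^sup>2) ^ Suc k / real (Suc k) - 0 ^ Suc k / real (Suc k)) = pi * r ^ (2 * k + 2) / (real k + 1)"
    by (simp add: power2_eq_square power_add power_mult add.commute)
  ultimately show ?thesis
    by (simp only: ennreal_mult'[symmetric] pi_ge_zero)
qed

lemma nn_integral_cball_hyperbolic:
  assumes "0 \<le> r" "r < 1"
  shows "(\<integral>\<^sup>+z. ennreal (1 / (1 - (cmod z)\<^sup>2)\<^sup>2) * indicator (cball 0 r) z \<partial>lborel) =
    ennreal (pi * r\<^sup>2 / (1 - r\<^sup>2))"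
proof -
  have r2: "r\<^sup>2 < 1" using assms by (simp add: power_less_one_iff abs_square_less_1)
  have "(\<integral>\<^sup>+z. ennreal (1 / (1 - (cmod z)\<^sup>2)\<^sup>2) * indicator (cball 0 r) z \<partial>lborel) =
      ennreal pi * (\<integral>\<^sup>+t. ennreal (1 / (1 - t)\<^sup>2) * indicator {0..r\<^sup>2} t \<partial>lborel)"
    by (rule nn_integral_radial_cball) (use assms in auto)
  also have "(\<integral>\<^sup>+t. ennreal (1 / (1 - t)\<^sup>2) * indicator {0..r\<^sup>2} t \<partial>lborel) =
      ennreal (1 / (1 - r\<^sup>2) - 1 / (1 - 0))"
    by (rule nn_integral_FTC_Icc)
      (use r2 in \<open>auto intro!: derivative_eq_intros simp: power2_eq_square\<close>)
  also have "1 / (1 - r\<^sup>2) - 1 / (1 - 0) = r\<^sup>2 / (1 - r\<^sup>2)"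
    using r2 by (simp add: field_simps)
  finally show ?thesis
    by (simp add: ennreal_mult'[symmetric])
qed

text \<open>A rotation preserves the disc and area and multiplies the integrand by a constant; for a
  suitable angle this constant is -1, and the integral equals its own negative.\<close>

lemma integral_cball_monomials_orthogonal:
  fixes j k :: nat
  assumes "j < k"
  shows "(\<integral>z. indicator (cball 0 r) z *\<^sub>R (z ^ j * cnj (z ^ k)) \<partial>(lborel :: complex measure)) = 0"
proof -
  \<comment> \<open>The angle pi/(k - j) gives a^(k-j) = -1, and since |a| = 1 the factor a^j
    cnj(a^k) reduces to cnj(a^(k-j)).\<close>
  define a where "a = cis (pi / real (k - j))"
  have a: "cmod a = 1" "a \<noteq> 0" by (simp_all add: a_def)
  have ak: "a ^ (k - j) = -1"
    using assms by (simp add: a_def Complex.DeMoivre)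
  have D: "distr lborel borel (\<lambda>z. a * z) = (lborel :: complex measure)"
  proof (rule lborel_eqI[symmetric])
    fix l u :: complex assume le: "\<And>b. b \<in> Basis \<Longrightarrow> l \<bullet> b \<le> u \<bullet> b"
    have pre: "(\<lambda>z. a * z) -` box l u = (\<lambda>z. z / a) ` box l u"
      using a by (auto simp: image_iff field_simps)
    \<comment> \<open>Rotation invariance of area is a case of the holomorphic area formula, the
      derivative 1/a having modulus 1. The closed box is the compact set required there, and the
      Borel set cuts it down to the open box.\<close>
    have "emeasure lborel ((\<lambda>z. z / a) ` cbox l u \<inter> (\<lambda>z. z / a) ` box l u) =
       (\<integral>\<^sup>+z. ennreal ((cmod (deriv (\<lambda>z. z / a) z))\<^sup>2) * indicator (cbox l u \<inter> (\<lambda>z. z / a) -` ((\<lambda>z. z / a) ` box l u)) z \<partial>lborel)"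
    proof (rule emeasure_holomorphic_image[where T = UNIV])
      have "open ((\<lambda>z. a * z) -` box l u)" by (intro open_vimage open_box continuous_intros)
      then show "(\<lambda>z. z / a) ` box l u \<in> sets borel" unfolding pre by simp
    qed (use a in \<open>auto intro!: holomorphic_intros inj_onI\<close>)
    also have "deriv (\<lambda>z. z / a) = (\<lambda>z. 1 / a)"
      using a by (intro ext DERIV_imp_deriv) (auto intro!: derivative_eq_intros)
    also have "(\<lambda>z. z / a) -` ((\<lambda>z. z / a) ` box l u) = box l u"
      using a by (auto simp: image_iff)
    also have "cbox l u \<inter> box l u = box l u" using box_subset_cbox by blast
    also have "(\<lambda>z. z / a) ` cbox l u \<inter> (\<lambda>z. z / a) ` box l u = (\<lambda>z. z / a) ` box l u"
      using box_subset_cbox by blast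
    finally have "emeasure lborel ((\<lambda>z. z / a) ` box l u) = emeasure lborel (box l u)"
      using a by (simp add: norm_divide)
    then show "emeasure (distr lborel borel (\<lambda>z. a * z)) (box l u) = (\<Prod>b\<in>Basis. (u - l) \<bullet> b)"
      using le by (simp add: emeasure_distr pre)
  qed simp
  let ?g = "\<lambda>z::complex. indicator (cball 0 r) z *\<^sub>R (z ^ j * cnj (z ^ k))"
  have gm: "?g \<in> borel_measurable borel"
    by (intro borel_measurable_continuous_on_indicator continuous_intros) auto
  have aa: "a ^ j * cnj (a ^ k) = -1"
  proof -
    have "a * cnj a = 1" using a by (simp add: complex_mult_cnj cmod_def)
    then have "a ^ j * cnj (a ^ k) = (a * cnj a) ^ j * cnj (a ^ (k - j))"
      using power_add[of "cnj a" j "k - j"] assms power_mult_distrib[of a "cnj a" j] by simp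
    then show ?thesis using ak \<open>a * cnj a = 1\<close> by simp
  qed
  have "(\<integral>z. ?g z \<partial>lborel) = (\<integral>z. ?g z \<partial>distr lborel borel (\<lambda>z. a * z))"
    by (simp only: D)
  also have "\<dots> = (\<integral>z. ?g (a * z) \<partial>lborel)"
    by (rule integral_distr[OF _ gm]) simp
  also have "(\<lambda>z. ?g (a * z)) = (\<lambda>z. (a ^ j * cnj (a ^ k)) * ?g z)"
    using a by (auto simp: indicator_def power_mult_distrib norm_mult)
  also have "(\<integral>z. (a ^ j * cnj (a ^ k)) * ?g z \<partial>lborel) = - (\<integral>z. ?g z \<partial>lborel)"
    unfolding aa by simp
  finally show ?thesis by simp
qed

text \<open>Orthogonality leaves only the diagonal terms for a partial sum. Absolute convergence at
  radius r bounds all partial sums on the disc by one constant, so dominated convergence reaches the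
  full series.\<close>

lemma nn_integral_power_series_cball:
  fixes c :: "nat \<Rightarrow> complex"
  assumes r: "0 \<le> r" and sm: "summable (\<lambda>k. norm (c k) * r ^ k)"
  shows "(\<integral>\<^sup>+z. ennreal ((cmod (\<Sum>k. c k * z ^ k))\<^sup>2) * indicator (cball 0 r) z \<partial>lborel) =
    (\<Sum>k. ennreal (pi * (cmod (c k))\<^sup>2 * r ^ (2 * k + 2) / (real k + 1)))"
proof -
  define P where "P N z = (\<Sum>k<N. c k * z ^ k)" for N z
  let ?I = "\<lambda>z. indicator (cball 0 r) z :: real"
  have contP: "continuous_on X (P N)" for X N
    unfolding P_def by (intro continuous_intros)
  have cint: "integrable lborel (\<lambda>z. ?I z *\<^sub>R f z)" if "continuous_on (cball 0 r) f"
    for f :: "complex \<Rightarrow> complex" by (rule borel_integrable_compact[OF compact_cball that])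
  have rint: "integrable lborel (\<lambda>z. ?I z *\<^sub>R f z)" if "continuous_on (cball 0 r) f"
    for f :: "complex \<Rightarrow> real" by (rule borel_integrable_compact[OF compact_cball that])
  have mono: "(\<integral>z. ?I z *\<^sub>R (cmod (z ^ k))\<^sup>2 \<partial>lborel) = pi * r ^ (2 * k + 2) / (real k + 1)" for k
  proof -
    have "(\<integral>\<^sup>+z. ennreal (?I z *\<^sub>R (cmod (z ^ k))\<^sup>2) \<partial>lborel) = ennreal (pi * r ^ (2 * k + 2) / (real k + 1))"
      unfolding nn_integral_cball_norm_power[OF r, symmetric]
      by (intro nn_integral_cong) (auto simp: indicator_def)
    moreover have "(\<integral>\<^sup>+z. ennreal (?I z *\<^sub>R (cmod (z ^ k))\<^sup>2) \<partial>lborel) =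
        ennreal (\<integral>z. ?I z *\<^sub>R (cmod (z ^ k))\<^sup>2 \<partial>lborel)"
      by (rule nn_integral_eq_integral) (intro rint continuous_intros, simp)
    ultimately have "ennreal (\<integral>z. ?I z *\<^sub>R (cmod (z ^ k))\<^sup>2 \<partial>lborel) =
        ennreal (pi * r ^ (2 * k + 2) / (real k + 1))" by simp
    then show ?thesis
      using r by (subst (asm) ennreal_inj) (auto intro!: Bochner_Integration.integral_nonneg)
  qed
  \<comment> \<open>\<open>P N\<close> involves only powers below N, so the next monomial is
    orthogonal to it and contributes just its own square in the induction for
    \<open>poly\<close>.\<close>
  have cross: "(\<integral>z. ?I z *\<^sub>R (P N z * cnj (c N * z ^ N)) \<partial>lborel) = 0" for N
  proof -
    have "(\<integral>z. ?I z *\<^sub>R (P N z * cnj (c N * z ^ N)) \<partial>lborel) =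
        (\<integral>z. (\<Sum>k<N. (c k * cnj (c N)) * (?I z *\<^sub>R (z ^ k * cnj (z ^ N)))) \<partial>lborel)"
      by (intro Bochner_Integration.integral_cong)
        (auto simp: P_def sum_distrib_left sum_distrib_right scaleR_sum_right mult_ac)
    also have "\<dots> = (\<Sum>k<N. (\<integral>z. (c k * cnj (c N)) * (?I z *\<^sub>R (z ^ k * cnj (z ^ N))) \<partial>lborel))"
      by (intro Bochner_Integration.integral_sum integrable_mult_right cint continuous_intros)
    also have "\<dots> = 0"
      by (intro sum.neutral ballI, subst integral_mult_right_zero)
        (simp only: integral_cball_monomials_orthogonal lessThan_iff mult_zero_right)
    finally show ?thesis .
  qed
  have poly: "(\<integral>z. ?I z *\<^sub>R (cmod (P N z))\<^sup>2 \<partial>lborel) =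
      (\<Sum>k<N. pi * (cmod (c k))\<^sup>2 * r ^ (2 * k + 2) / (real k + 1))" for N
  proof (induction N)
    case 0
    then show ?case by (simp add: P_def)
  next
    case (Suc N)
    have exp: "?I z *\<^sub>R (cmod (P (Suc N) z))\<^sup>2 = ?I z *\<^sub>R (cmod (P N z))\<^sup>2 +
        ((cmod (c N))\<^sup>2 * (?I z *\<^sub>R (cmod (z ^ N))\<^sup>2) + 2 * Re (?I z *\<^sub>R (P N z * cnj (c N * z ^ N))))" for z
    proof -
      have "(cmod (a + b))\<^sup>2 = (cmod a)\<^sup>2 + ((cmod b)\<^sup>2 + 2 * Re (a * cnj b))" for a b
        by (simp only: cmod_power2) (simp add: power2_eq_square algebra_simps)
      from this[of "P N z" "c N * z ^ N"]
      have "(cmod (P (Suc N) z))\<^sup>2 = (cmod (P N z))\<^sup>2 +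
          ((cmod (c N))\<^sup>2 * (cmod (z ^ N))\<^sup>2 + 2 * Re (P N z * cnj (c N * z ^ N)))"
        by (simp only: P_def sum.lessThan_Suc norm_mult power_mult_distrib)
      moreover have "i *\<^sub>R L = i *\<^sub>R A + (B * (i *\<^sub>R b) + 2 * Re (i *\<^sub>R X))"
        if "L = A + (B * b + 2 * Re X)" for i L A B b and X :: complex
        by (simp add: that algebra_simps)
      ultimately show ?thesis by blast
    qed
    have i3: "integrable lborel (\<lambda>z. ?I z *\<^sub>R (P N z * cnj (c N * z ^ N)))"
      by (intro cint continuous_intros contP)
    have "(\<integral>z. ?I z *\<^sub>R (cmod (P (Suc N) z))\<^sup>2 \<partial>lborel) =
       (\<integral>z. ?I z *\<^sub>R (cmod (P N z))\<^sup>2 \<partial>lborel) +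
       ((\<integral>z. (cmod (c N))\<^sup>2 * (?I z *\<^sub>R (cmod (z ^ N))\<^sup>2) \<partial>lborel) +
        (\<integral>z. 2 * Re (?I z *\<^sub>R (P N z * cnj (c N * z ^ N))) \<partial>lborel))"
      unfolding exp
      by (subst Bochner_Integration.integral_add Bochner_Integration.integral_add,
          intro rint continuous_intros contP,
          intro Bochner_Integration.integrable_add integrable_mult_right rint continuous_intros integrable_Re i3,
          subst Bochner_Integration.integral_add,
          intro integrable_mult_right rint continuous_intros,
          intro integrable_mult_right integrable_Re i3, rule refl)
    also have "(\<integral>z. 2 * Re (?I z *\<^sub>R (P N z * cnj (c N * z ^ N))) \<partial>lborel) = 0"
      by (simp only: integral_mult_right_zero integral_Re[OF i3] cross) simp
    also have "(\<integral>z. (cmod (c N))\<^sup>2 * (?I z *\<^sub>R (cmod (z ^ N))\<^sup>2) \<partial>lborel) =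
        pi * (cmod (c N))\<^sup>2 * r ^ (2 * N + 2) / (real N + 1)"
      by (simp only: integral_mult_right_zero mono) simp
    finally show ?case by (simp only: Suc sum.lessThan_Suc add_0_right)
  qed
  have lim: "(\<lambda>N. P N z) \<longlonglongrightarrow> (\<Sum>k. c k * z ^ k)" and bound: "cmod (P N z) \<le> (\<Sum>k. norm (c k) * r ^ k)"
    if "z \<in> cball 0 r" for N z unfolding atomize_conj
  proof -
    have le: "norm (c k * z ^ k) \<le> norm (c k) * r ^ k" for k
      using that by (auto simp: norm_mult norm_power intro!: mult_left_mono power_mono)
    have "summable (\<lambda>k. c k * z ^ k)"
      by (rule summable_comparison_test'[OF sm]) (use le in auto)
    moreover have "cmod (P N z) \<le> (\<Sum>k<N. norm (c k) * r ^ k)"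
      unfolding P_def by (rule sum_norm_le) (use le in auto)
    moreover have "\<dots> \<le> (\<Sum>k. norm (c k) * r ^ k)"
      by (rule sum_le_suminf[OF sm]) (use r in auto)
    ultimately show "(\<lambda>N. P N z) \<longlonglongrightarrow> (\<Sum>k. c k * z ^ k) \<and> cmod (P N z) \<le> (\<Sum>k. norm (c k) * r ^ k)"
      using summable_LIMSEQ unfolding P_def by fastforce
  qed
  define C where "C = (\<Sum>k. norm (c k) * r ^ k)"
  have "(\<lambda>N. \<integral>\<^sup>+z. ennreal ((cmod (P N z))\<^sup>2) * indicator (cball 0 r) z \<partial>lborel) \<longlonglongrightarrow>
      (\<integral>\<^sup>+z. ennreal ((cmod (\<Sum>k. c k * z ^ k))\<^sup>2) * indicator (cball 0 r) z \<partial>lborel)"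
  proof (rule nn_integral_dominated_convergence[where w = "\<lambda>z. ennreal (C\<^sup>2) * indicator (cball 0 r) z"])
    define K where "K = cball (0::complex) r"
    have [measurable]: "K \<in> sets borel"
      unfolding K_def by (rule borel_closed) simp
    have [measurable]: "P N \<in> borel_measurable borel" for N
      by (intro borel_measurable_continuous_onI contP)
    show "(\<lambda>z. ennreal ((cmod (P N z))\<^sup>2) * indicator (cball 0 r) z) \<in> borel_measurable lborel" for N
      unfolding K_def[symmetric] by measurable
    show "(\<lambda>z. ennreal ((cmod (\<Sum>k. c k * z ^ k))\<^sup>2) * indicator (cball 0 r) z) \<in> borel_measurable lborel"
      unfolding K_def[symmetric] by measurable
    show "AE z in lborel. ennreal ((cmod (P N z))\<^sup>2) * indicator (cball 0 r) z \<le> ennreal (C\<^sup>2) * indicator (cball 0 r) z" for N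
      by (intro AE_I2) (auto simp: indicator_def C_def intro!: ennreal_leI power_mono bound)
    show "(\<integral>\<^sup>+z. ennreal (C\<^sup>2) * indicator (cball 0 r) z \<partial>(lborel::complex measure)) < \<infinity>"
      using r by (simp add: nn_integral_cmult_indicator emeasure_cball ennreal_mult_less_top)
    show "AE z in lborel. (\<lambda>N. ennreal ((cmod (P N z))\<^sup>2) * indicator (cball 0 r) z) \<longlonglongrightarrow>
        ennreal ((cmod (\<Sum>k. c k * z ^ k))\<^sup>2) * indicator (cball 0 r) z"
      by (intro AE_I2) (auto simp: indicator_def intro!: tendsto_intros lim)
    show "(\<lambda>z. ennreal (C\<^sup>2) * indicator (cball 0 r) z) \<in> borel_measurable (lborel::complex measure)"
      unfolding K_def[symmetric] by measurable
  qed
  moreover have "(\<integral>\<^sup>+z. ennreal ((cmod (P N z))\<^sup>2) * indicator (cball 0 r) z \<partial>lborel) =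
      (\<Sum>k<N. ennreal (pi * (cmod (c k))\<^sup>2 * r ^ (2 * k + 2) / (real k + 1)))" for N
  proof -
    have "(\<integral>\<^sup>+z. ennreal ((cmod (P N z))\<^sup>2) * indicator (cball 0 r) z \<partial>lborel) =
        (\<integral>\<^sup>+z. ennreal (?I z *\<^sub>R (cmod (P N z))\<^sup>2) \<partial>lborel)"
      by (intro nn_integral_cong) (auto simp: indicator_def)
    also have "\<dots> = ennreal (\<integral>z. ?I z *\<^sub>R (cmod (P N z))\<^sup>2 \<partial>lborel)"
      by (rule nn_integral_eq_integral) (intro rint continuous_intros contP, simp)
    also have "\<dots> = (\<Sum>k<N. ennreal (pi * (cmod (c k))\<^sup>2 * r ^ (2 * k + 2) / (real k + 1)))"
      unfolding poly using r by (subst sum_ennreal) auto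
    finally show ?thesis .
  qed
  moreover have "(\<lambda>N. \<Sum>k<N. ennreal (pi * (cmod (c k))\<^sup>2 * r ^ (2 * k + 2) / (real k + 1))) \<longlonglongrightarrow>
      (\<Sum>k. ennreal (pi * (cmod (c k))\<^sup>2 * r ^ (2 * k + 2) / (real k + 1)))"
    by (rule summable_LIMSEQ) simp
  ultimately show ?thesis
    using LIMSEQ_unique by auto
qed

section \<open>Riemann maps of loops\<close>

lemma homeomorphic_maps_top_of_set_iff:
  "homeomorphic_maps (top_of_set S) (top_of_set T) f g \<longleftrightarrow> homeomorphism S T f g"
  by (force simp: Pi_iff homeomorphic_maps_def homeomorphism_def)

lemma Loop_top_of_set_iff:
  fixes \<gamma> :: "complex set"
  shows
  "\<gamma> \<in> Loop (top_of_set D) \<longleftrightarrow> \<gamma> \<subseteq> D \<and> compact \<gamma> \<and> \<gamma> homeomorphic sphere (0::complex) 1"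
proof -
  have "subtopology (top_of_set D) \<gamma> = top_of_set \<gamma>" if "\<gamma> \<subseteq> D"
    using that by (simp add: subtopology_subtopology Int_absorb1)
  moreover have "top_of_set \<gamma> homeomorphic_space top_of_set (sphere (0::complex) 1) \<longleftrightarrow>
      \<gamma> homeomorphic sphere (0::complex) 1"
    by (simp only: homeomorphic_space_def homeomorphic_def homeomorphic_maps_top_of_set_iff)
  ultimately show ?thesis
    unfolding Loop_def by (auto simp: compactin_subtopology)
qed

text \<open>A homeomorphism from the circle composed with \<open>circlepath 0 1\<close> is a simple
  closed path with image \<gamma>, to which the Jordan curve theorem applies.\<close>

lemma homeomorphic_circle_inside:
  fixes \<gamma> :: "complex set"
  assumes "\<gamma> homeomorphic sphere (0::complex) 1"
  shows "open (inside \<gamma>)" "connected (inside \<gamma>)" "bounded (inside \<gamma>)"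
    "simply_connected (inside \<gamma>)" "frontier (inside \<gamma>) = \<gamma>"
proof -
  have "sphere (0::complex) 1 homeomorphic \<gamma>"
    by (rule iffD1[OF homeomorphic_sym assms])
  then obtain f g where fg: "homeomorphism (sphere (0::complex) 1) \<gamma> f g"
    unfolding homeomorphic_def by (elim exE)
  define c where "c = f \<circ> circlepath 0 1"
  have "inj_on f (sphere 0 1)"
    using homeomorphism_apply1[OF fg] by (rule inj_on_inverseI)
  then have "simple_path c"
    unfolding c_def using fg
    by (intro simple_path_continuous_image) (auto simp: simple_path_circlepath homeomorphism_def)
  moreover have "pathfinish c = pathstart c"
    unfolding c_def by (simp add: pathfinish_compose pathstart_compose)
  moreover have "path_image c = \<gamma>"
    unfolding c_def using fg by (simp add: path_image_compose homeomorphism_def)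
  ultimately show "open (inside \<gamma>)" "connected (inside \<gamma>)" "bounded (inside \<gamma>)"
    "simply_connected (inside \<gamma>)" "frontier (inside \<gamma>) = \<gamma>"
    using Jordan_inside_outside[of c] simply_connected_inside_simple_path[of c] by auto
qed

lemma insideD: "x \<in> inside S \<Longrightarrow> x \<notin> S"
  by (simp add: inside_def)

lemma Loop1_iff:
  "\<gamma> \<in> Loop1 \<longleftrightarrow> compact \<gamma> \<and> \<gamma> homeomorphic sphere (0::complex) 1 \<and> 0 \<in> inside \<gamma>"
  by (auto simp: Loop1_def Loop_top_of_set_iff surrounds_zero_def dest: insideD)

lemma Loop1_component: "\<gamma> \<in> Loop1 \<Longrightarrow> connected_component_set (- \<gamma>) 0 = inside \<gamma>"
proof (intro equalityI)
  assume \<gamma>: "\<gamma> \<in> Loop1"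
  show "connected_component_set (- \<gamma>) 0 \<subseteq> inside \<gamma>"
    using \<gamma> inside_same_component by (auto simp: Loop1_iff)
  show "inside \<gamma> \<subseteq> connected_component_set (- \<gamma>) 0"
    using \<gamma> homeomorphic_circle_inside[of \<gamma>]
    by (intro connected_component_maximal) (auto simp: Loop1_iff dest: insideD)
qed

lemma conformal_iso_inverse:
  assumes "conformal_iso D E f" "open D"
  shows "conformal_iso E D (inv_into D f)"
proof -
  have inj: "inj_on f D" and im: "f ` D = E" and hol: "f holomorphic_on D"
    using assms by (auto simp: conformal_iso_def bij_betw_def)
  obtain g where g: "g holomorphic_on f ` D" "\<And>z. z \<in> D \<Longrightarrow> g (f z) = z"
    using holomorphic_has_inverse[OF hol \<open>open D\<close> inj] by metis
  have "inv_into D f holomorphic_on E"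
    by (rule holomorphic_transform[OF g(1)[unfolded im]]) (use g inj im in force)
  then show ?thesis
    using assms by (auto simp: conformal_iso_def intro: bij_betw_inv_into)
qed

lemma conformal_iso_compose:
  assumes "conformal_iso D E f" "conformal_iso E F g"
  shows "conformal_iso D F (g \<circ> f)"
proof -
  have "g \<circ> f holomorphic_on D"
    using assms by (intro holomorphic_on_compose_gen[where t = E]) (auto simp: conformal_iso_def bij_betw_def)
  then show ?thesis
    using assms by (auto simp: conformal_iso_def intro: bij_betw_trans)
qed

text \<open>The self-map h = g^-1 f of the disc and its inverse both fix 0. The Schwarz lemma for
  the two together gives |h z| = |z|, the equality case, in which h is a rotation.\<close>

lemma conformal_iso_disc_unique:
  assumes f: "conformal_iso (ball 0 1) U f" and g: "conformal_iso (ball 0 1) U g" and eq: "f 0 = g 0"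
  obtains \<alpha> where "cmod \<alpha> = 1" "\<And>z. z \<in> ball 0 1 \<Longrightarrow> f z = g (\<alpha> * z)"
proof -
  let ?B = "ball 0 1 :: complex set"
  have le: "cmod (inv_into ?B q (p z)) \<le> cmod z" "inv_into ?B q (p z) \<in> ?B"
     "conformal_iso ?B ?B (inv_into ?B q \<circ> p)" "q (inv_into ?B q (p z)) = p z"
     "inv_into ?B q (p 0) = 0"
    if p: "conformal_iso ?B U p" and q: "conformal_iso ?B U q" and e: "p 0 = q 0" and z: "z \<in> ?B"
    for p q z
  proof -
    have h: "conformal_iso ?B ?B (inv_into ?B q \<circ> p)"
      by (rule conformal_iso_compose[OF p conformal_iso_inverse[OF q]]) simp
    have inB: "inv_into ?B q (p z) \<in> ?B" if "z \<in> ?B" for z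
      using h that by (auto simp: conformal_iso_def bij_betw_def)
    have inj: "inj_on q ?B" using q by (auto simp: conformal_iso_def bij_betw_def)
    show 0: "inv_into ?B q (p 0) = 0"
      unfolding e by (rule inv_into_f_f[OF inj]) simp
    show "conformal_iso ?B ?B (inv_into ?B q \<circ> p)" "inv_into ?B q (p z) \<in> ?B" using h inB z by auto
    show "cmod (inv_into ?B q (p z)) \<le> cmod z"
      using Schwarz_Lemma(1)[of "inv_into ?B q \<circ> p" z] h inB z 0 by (auto simp: conformal_iso_def)
    have "p z \<in> q ` ?B" using p q z by (auto simp: conformal_iso_def bij_betw_def)
    then show "q (inv_into ?B q (p z)) = p z" by (rule f_inv_into_f)
  qed
  define h where "h = inv_into ?B g \<circ> f"
  note f1 = le[OF f g eq] and g1 = le[OF g f eq[symmetric]]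
  have hk: "inv_into ?B f (g (h z)) = z" if "z \<in> ?B" for z
  proof -
    have "inj_on f ?B" using f by (auto simp: conformal_iso_def bij_betw_def)
    then show ?thesis using f1(4)[OF that] that by (simp add: h_def)
  qed
  have norm_eq: "cmod (h z) = cmod z" if "z \<in> ?B" for z
  proof (rule antisym)
    show "cmod (h z) \<le> cmod z" using f1(1)[OF that] by (simp add: h_def)
    have "h z \<in> ?B" using f1(2)[OF that] by (simp add: h_def)
    then show "cmod z \<le> cmod (h z)" using g1(1)[of "h z"] hk[OF that] by simp
  qed
  have "\<exists>\<alpha>. (\<forall>z. cmod z < 1 \<longrightarrow> h z = \<alpha> * z) \<and> cmod \<alpha> = 1"
  proof (rule Schwarz_Lemma(3)[where \<xi> = 0])
    show "h holomorphic_on ?B" using f1(3)[of 0] by (simp add: h_def conformal_iso_def)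
    show "h 0 = 0" using f1(5)[of 0] by (simp add: h_def)
    show "\<And>z. cmod z < 1 \<Longrightarrow> cmod (h z) < 1" using norm_eq by simp
    \<comment> \<open>Equality at one nonzero point suffices; 1/2 is an arbitrary choice.\<close>
    show "(\<exists>z. cmod z < 1 \<and> z \<noteq> 0 \<and> cmod (h z) = cmod z) \<or> cmod (deriv h 0) = 1"
      using norm_eq[of "1/2"] by (intro disjI1 exI[of _ "1/2"]) auto
  qed simp
  then obtain \<alpha> where \<alpha>: "\<And>z. cmod z < 1 \<Longrightarrow> h z = \<alpha> * z" "cmod \<alpha> = 1" by blast
  show ?thesis
    by (rule that[OF \<alpha>(2)]) (use \<alpha>(1) f1(4) in \<open>auto simp: h_def\<close>)
qed

section \<open>Disc automorphisms and the normalized interior map\<close>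

lemma conformal_iso_Moebius:
  assumes "cmod a < 1"
  shows "conformal_iso (ball 0 1) (ball 0 1) (Moebius_function 0 a)"
  unfolding conformal_iso_def
proof
  show "Moebius_function 0 a holomorphic_on ball 0 1" by (rule Moebius_function_holomorphic[OF assms])
  show "bij_betw (Moebius_function 0 a) (ball 0 1) (ball 0 1)"
    by (rule bij_betw_byWitness[where f' = "Moebius_function 0 (- a)"])
      (use assms Moebius_function_compose[of a "- a"] Moebius_function_compose[of "- a" a]
        Moebius_function_norm_lt_1 in \<open>auto\<close>)
qed

lemma has_field_derivative_Moebius_0:
  "(Moebius_function 0 a has_field_derivative 1 - (cmod a)\<^sup>2) (at 0)"
proof -
  have "((\<lambda>z. (z - a) / (1 - cnj a * z)) has_field_derivative (1 * 1 - (- a) * (- cnj a)) / (1 * 1)) (at 0)"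
    by (rule derivative_eq_intros refl | simp)+
  moreover have "(1 * 1 - (- a) * (- cnj a)) / (1 * 1) = of_real (1 - (cmod a)\<^sup>2)"
    by (simp add: complex_norm_square[symmetric] flip: of_real_power)
  ultimately show ?thesis
    by (simp add: Moebius_function_simple[abs_def])
qed

lemma conformal_iso_rotation:
  assumes "cmod a = 1"
  shows "conformal_iso (ball 0 1) (ball 0 1) (\<lambda>z. a * z)"
  unfolding conformal_iso_def
proof
  show "bij_betw (\<lambda>z. a * z) (ball 0 1) (ball 0 1)"
    by (rule bij_betw_byWitness[where f' = "\<lambda>z. z / a"])
      (use assms in \<open>auto simp: norm_mult norm_divide\<close>)
qed (auto intro!: holomorphic_intros)

lemma interior_map_exists:
  assumes "\<gamma> \<in> Loop1"
  shows "\<exists>u \<rho>. interior_map \<gamma> \<rho> u"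
proof -
  let ?B = "ball 0 1 :: complex set"
  have h: "\<gamma> homeomorphic sphere (0::complex) 1" and 0: "0 \<in> inside \<gamma>"
    using assms by (auto simp: Loop1_iff)
  note ins = homeomorphic_circle_inside[OF h]
  have "inside \<gamma> \<noteq> UNIV" using ins(3) by auto
  then obtain f g where fg: "f holomorphic_on inside \<gamma>" "g holomorphic_on ?B"
    "\<And>z. z \<in> inside \<gamma> \<Longrightarrow> f z \<in> ?B \<and> g (f z) = z" "\<And>z. z \<in> ?B \<Longrightarrow> g z \<in> inside \<gamma> \<and> f (g z) = z"
    using Riemann_mapping_theorem[of "inside \<gamma>"] ins 0 by blast
  define a where "a = f 0"
  have a: "cmod a < 1" using fg(3)[OF 0] by (simp add: a_def)
  have g: "conformal_iso ?B (inside \<gamma>) g"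
    unfolding conformal_iso_def using fg by (auto intro!: bij_betw_byWitness[where f' = f])
  \<comment> \<open>This automorphism sends 0 to a = f 0, the point that g maps to 0, so
    \<open>p\<close> fixes 0.\<close>
  define p where "p = g \<circ> Moebius_function 0 (- a)"
  have p: "conformal_iso ?B (inside \<gamma>) p"
    unfolding p_def by (rule conformal_iso_compose[OF conformal_iso_Moebius g]) (use a in simp)
  have p0: "p 0 = 0" using fg(3)[OF 0] by (simp add: p_def Moebius_function_of_zero a_def)
  have "deriv p 0 \<noteq> 0"
    using p by (intro holomorphic_injective_imp_regular[where S = ?B]) (auto simp: conformal_iso_def bij_betw_def)
  define \<rho> where "\<rho> = cmod (deriv p 0)"
  \<comment> \<open>The rotation that makes the derivative at 0 real and positive: p'(0) b =
    \<rho>.\<close>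
  define b where "b = of_real \<rho> / deriv p 0"
  have \<rho>: "\<rho> > 0" and b: "cmod b = 1"
    using \<open>deriv p 0 \<noteq> 0\<close> by (simp_all add: \<rho>_def b_def norm_divide)
  define q where "q = p \<circ> (\<lambda>z. b * z)"
  have q: "conformal_iso ?B (inside \<gamma>) q"
    unfolding q_def by (rule conformal_iso_compose[OF conformal_iso_rotation[OF b] p])
  have "p holomorphic_on ?B" using p by (simp add: conformal_iso_def)
  then have "(p has_field_derivative deriv p 0) (at 0)"
    by (rule holomorphic_derivI[where S = ?B]) auto
  then have "(q has_field_derivative deriv p 0 * b) (at 0)"
    unfolding q_def by (intro DERIV_chain) (auto intro!: derivative_eq_intros)
  then have dq: "(q has_field_derivative of_real \<rho>) (at 0)"
    using \<open>deriv p 0 \<noteq> 0\<close> by (simp add: b_def)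
  define u where "u = restrict (\<lambda>z. q z / of_real \<rho>) ?B"
  have uq: "of_real \<rho> * u z = q z" if "z \<in> ?B" for z
    using that \<rho> by (simp add: u_def)
  have "(u has_field_derivative of_real \<rho> / of_real \<rho>) (at 0)"
    by (rule has_field_derivative_transform_within_open[where f = "\<lambda>z. q z / of_real \<rho>" and S = ?B])
      (use \<rho> in \<open>auto simp: u_def intro!: derivative_eq_intros dq\<close>)
  then have "deriv u 0 = 1" using \<rho> DERIV_imp_deriv by fastforce
  moreover have "conformal_iso ?B (connected_component_set (- \<gamma>) 0) (\<lambda>z. of_real \<rho> * u z)"
    unfolding Loop1_component[OF assms] conformal_iso_def
  proof
    show "(\<lambda>z. of_real \<rho> * u z) holomorphic_on ?B"
      by (rule holomorphic_transform[of q]) (use q uq in \<open>auto simp: conformal_iso_def\<close>)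
    show "bij_betw (\<lambda>z. of_real \<rho> * u z) ?B (inside \<gamma>)"
      using q uq bij_betw_cong[of ?B "\<lambda>z. of_real \<rho> * u z" q] by (simp add: conformal_iso_def)
  qed
  moreover have "u 0 = 0" by (simp add: u_def q_def p0)
  moreover have "u \<in> extensional ?B" by (simp add: u_def)
  ultimately show ?thesis unfolding interior_map_def using \<rho> by blast
qed

text \<open>The two Riemann maps differ by a rotation \<alpha>. Comparing derivatives at 0 gives
  \<rho> = \<rho>' \<alpha>, and positivity of both radii forces \<alpha> = 1.\<close>

lemma interior_map_unique:
  assumes 1: "interior_map \<gamma> \<rho> u" and 2: "interior_map \<gamma> \<rho>' u'"
  shows "u = u'" "\<rho> = \<rho>'"
proof -
  let ?B = "ball 0 1 :: complex set"
  obtain \<alpha> where \<alpha>: "cmod \<alpha> = 1" "\<And>z. z \<in> ?B \<Longrightarrow> of_real \<rho> * u z = of_real \<rho>' * u' (\<alpha> * z)"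
    using conformal_iso_disc_unique[of "connected_component_set (- \<gamma>) 0" "\<lambda>z. of_real \<rho> * u z" "\<lambda>z. of_real \<rho>' * u' z"] 1 2
    by (auto simp: interior_map_def)
  have d: "(w has_field_derivative 1) (at 0)" if "interior_map \<gamma> r w" for r w
  proof -
    have "(\<lambda>z. of_real r * w z) holomorphic_on ?B" "r > 0"
      using that by (auto simp: interior_map_def conformal_iso_def)
    then have "(\<lambda>z. (of_real r * w z) / of_real r) holomorphic_on ?B"
      by (intro holomorphic_on_divide holomorphic_on_const) auto
    then have "w holomorphic_on ?B"
      by (rule holomorphic_transform) (use \<open>r > 0\<close> in auto)
    then have "(w has_field_derivative deriv w 0) (at 0)"
      by (rule holomorphic_derivI[where S = ?B]) auto
    then show ?thesis using that by (simp add: interior_map_def)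
  qed
  have "((\<lambda>z. of_real \<rho> * u z) has_field_derivative of_real \<rho> * 1) (at 0)"
    by (rule DERIV_cmult[OF d[OF 1]])
  moreover have "((\<lambda>z. of_real \<rho>' * u' (\<alpha> * z)) has_field_derivative of_real \<rho>' * (1 * \<alpha>)) (at 0)"
    by (rule DERIV_cmult, rule DERIV_chain2[where f = u']) (use d[OF 2] in \<open>auto intro!: derivative_eq_intros\<close>)
  then have "((\<lambda>z. of_real \<rho> * u z) has_field_derivative of_real \<rho>' * (1 * \<alpha>)) (at 0)"
    by (rule has_field_derivative_transform_within_open[where S = ?B]) (use \<alpha>(2) in auto)
  ultimately have e: "of_real \<rho> = of_real \<rho>' * \<alpha>" using DERIV_unique by fastforce
  have pos: "\<rho> > 0" "\<rho>' > 0" using 1 2 by (auto simp: interior_map_def)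
  have "\<rho> = \<rho>'"
    using arg_cong[OF e, of cmod] pos \<alpha>(1) by (simp add: norm_mult)
  then have "\<alpha> = 1" using e pos by simp
  show "\<rho> = \<rho>'" by fact
  show "u = u'"
  proof (rule extensionalityI)
    show "u \<in> extensional ?B" "u' \<in> extensional ?B" using 1 2 by (auto simp: interior_map_def)
    show "\<And>z. z \<in> ?B \<Longrightarrow> u z = u' z" using \<alpha>(2) \<open>\<alpha> = 1\<close> \<open>\<rho> = \<rho>'\<close> pos by auto
  qed
qed

text \<open>The conformal radius of the inside seen from 0. It is not one of the coordinates in
  which \<open>\<mu>\<^sub>0\<close> is a product, so its measurability is established separately
  below.\<close>

definition loop_rho :: "complex set \<Rightarrow> real" where
  "loop_rho \<gamma> = (THE \<rho>. interior_map \<gamma> \<rho> (loop_u \<gamma>))"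

definition loop_phi :: "complex set \<Rightarrow> complex \<Rightarrow> complex" where
  "loop_phi \<gamma> z = of_real (loop_rho \<gamma>) * loop_u \<gamma> z"

lemma interior_map_loop: "\<gamma> \<in> Loop1 \<Longrightarrow> interior_map \<gamma> (loop_rho \<gamma>) (loop_u \<gamma>)"
proof -
  assume "\<gamma> \<in> Loop1"
  then obtain u \<rho> where *: "interior_map \<gamma> \<rho> u" using interior_map_exists by blast
  then have "loop_u \<gamma> = u"
    unfolding loop_u_def using interior_map_unique(1) by (intro the_equality) blast+
  moreover have "loop_rho \<gamma> = \<rho>"
    unfolding loop_rho_def \<open>loop_u \<gamma> = u\<close> using * interior_map_unique(2) by (intro the_equality) blast+
  ultimately show ?thesis using * by simp
qed

lemma
  assumes "\<gamma> \<in> Loop1"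
  shows loop_rho_pos: "loop_rho \<gamma> > 0"
    and conformal_iso_loop_phi: "conformal_iso (ball 0 1) (inside \<gamma>) (loop_phi \<gamma>)"
    and loop_phi_0: "loop_phi \<gamma> 0 = 0"
    and loop_u_holomorphic: "loop_u \<gamma> holomorphic_on ball 0 1"
    and inj_on_loop_phi: "inj_on (loop_phi \<gamma>) (ball 0 1)"
    and loop_phi_holomorphic: "loop_phi \<gamma> holomorphic_on ball 0 1"
    and loop_phi_image: "loop_phi \<gamma> ` ball 0 1 = inside \<gamma>"
    and deriv_loop_phi_0: "deriv (loop_phi \<gamma>) 0 = of_real (loop_rho \<gamma>)"
proof -
  note i = interior_map_loop[OF assms]
  show rho: "loop_rho \<gamma> > 0" and "loop_phi \<gamma> 0 = 0"
    using i by (auto simp: interior_map_def loop_phi_def)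
  show iso: "conformal_iso (ball 0 1) (inside \<gamma>) (loop_phi \<gamma>)"
    using i Loop1_component[OF assms] by (simp add: interior_map_def loop_phi_def[abs_def])
  then show hol: "loop_phi \<gamma> holomorphic_on ball 0 1" and "inj_on (loop_phi \<gamma>) (ball 0 1)"
    and "loop_phi \<gamma> ` ball 0 1 = inside \<gamma>"
    by (auto simp: conformal_iso_def bij_betw_def)
  have "(\<lambda>z. loop_phi \<gamma> z / of_real (loop_rho \<gamma>)) holomorphic_on ball 0 1"
    using rho by (intro holomorphic_intros hol) auto
  then show uh: "loop_u \<gamma> holomorphic_on ball 0 1"
    using rho by (simp add: loop_phi_def)
  have "(loop_u \<gamma> has_field_derivative deriv (loop_u \<gamma>) 0) (at 0)"
    by (rule holomorphic_derivI[OF uh]) auto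
  then show "deriv (loop_phi \<gamma>) 0 = of_real (loop_rho \<gamma>)"
    using i unfolding loop_phi_def[abs_def] by (intro DERIV_imp_deriv) (auto intro!: derivative_eq_intros simp: interior_map_def)
qed

section \<open>Translating loops and their uniformizing maps\<close>

lemma connected_component_translation:
  fixes S :: "'a::real_normed_vector set"
  assumes "connected_component S x y"
  shows "connected_component ((\<lambda>z. z - d) ` S) (x - d) (y - d)"
proof -
  obtain T where "connected T" "T \<subseteq> S" "x \<in> T" "y \<in> T"
    using assms by (auto simp: connected_component_def)
  then show ?thesis
    unfolding connected_component_def
    by (intro exI[of _ "(\<lambda>z. z - d) ` T"]) (auto intro!: connected_continuous_image continuous_intros)
qed

lemma outside_translation:
  fixes S :: "'a::real_normed_vector set"
  shows "outside ((\<lambda>z. z - d) ` S) = (\<lambda>z. z - d) ` outside S"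
proof -
  \<comment> \<open>Stated for every d and S because the reverse inclusion is the same fact for -d
    and the translated set.\<close>
  have sub: "(\<lambda>z. z - d) ` outside S \<subseteq> outside ((\<lambda>z. z - d) ` S)" for d and S :: "'a set"
  proof
    fix y assume "y \<in> (\<lambda>z. z - d) ` outside S"
    then obtain x where y: "y = x - d" and x: "\<not> bounded (connected_component_set (- S) x)"
      by (auto simp: outside)
    have c: "(\<lambda>z. z - d) ` (- S) = - (\<lambda>z. z - d) ` S"
      by (rule bij_image_Compl_eq) (rule bij_betw_byWitness[where f' = "\<lambda>z. z + d"], auto)
    have "(\<lambda>z. z - d) ` connected_component_set (- S) x \<subseteq> connected_component_set (- (\<lambda>z. z - d) ` S) y"
      using connected_component_translation[of "- S" x _ d] c y by auto
    moreover have "\<not> bounded ((\<lambda>z. z - d) ` connected_component_set (- S) x)"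
    proof
      assume "bounded ((\<lambda>z. z - d) ` connected_component_set (- S) x)"
      then have "bounded ((\<lambda>z. d + z) ` (\<lambda>z. z - d) ` connected_component_set (- S) x)"
        by (rule bounded_translation)
      then show False using x by (simp add: image_image)
    qed
    ultimately show "y \<in> outside ((\<lambda>z. z - d) ` S)"
      using bounded_subset by (auto simp: outside)
  qed
  have "outside ((\<lambda>z. z - d) ` S) = (\<lambda>z. z - d) ` (\<lambda>z. z - - d) ` outside ((\<lambda>z. z - d) ` S)"
    by (simp add: image_image)
  also have "\<dots> \<subseteq> (\<lambda>z. z - d) ` outside ((\<lambda>z. z - - d) ` (\<lambda>z. z - d) ` S)"
    by (intro image_mono sub)
  also have "(\<lambda>z. z - - d) ` (\<lambda>z. z - d) ` S = S"
    by (simp add: image_image)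
  finally show ?thesis using sub by blast
qed

lemma inside_translation:
  fixes S :: "'a::real_normed_vector set"
  shows "inside ((\<lambda>z. z - d) ` S) = (\<lambda>z. z - d) ` inside S"
proof -
  have "(\<lambda>z. z - d) ` (- (S \<union> outside S)) = - (\<lambda>z. z - d) ` (S \<union> outside S)"
    by (rule bij_image_Compl_eq) (rule bij_betw_byWitness[where f' = "\<lambda>z. z + d"], auto)
  then show ?thesis
    unfolding inside_outside outside_translation by (simp add: image_Un)
qed

lemma homeomorphic_circle_translation:
  "(\<lambda>z. z - d) ` \<gamma> homeomorphic sphere (0::complex) 1 \<longleftrightarrow> \<gamma> homeomorphic sphere (0::complex) 1"
  for \<gamma> :: "complex set"
proof -
  have "\<gamma> homeomorphic ((+) (- d) ` \<gamma>)" by (rule homeomorphic_translation)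
  also have "(+) (- d) ` \<gamma> = (\<lambda>z. z - d) ` \<gamma>" by auto
  finally have *: "\<gamma> homeomorphic (\<lambda>z. z - d) ` \<gamma>" .
  show ?thesis
    using homeomorphic_trans[OF *] homeomorphic_trans[OF iffD1[OF homeomorphic_sym *]] by (intro iffI)
qed

lemma Loop1_translation:
  assumes \<gamma>: "\<gamma> \<in> Loop1" and d: "d \<in> inside \<gamma>"
  shows "(\<lambda>z. z - d) ` \<gamma> \<in> Loop1"
proof -
  have "compact ((\<lambda>z. z - d) ` \<gamma>)"
    by (rule compact_translation_subtract) (use \<gamma> in \<open>simp add: Loop1_iff\<close>)
  moreover have "(\<lambda>z. z - d) ` \<gamma> homeomorphic sphere (0::complex) 1"
    using \<gamma> by (simp only: homeomorphic_circle_translation Loop1_iff)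
  moreover have "0 \<in> inside ((\<lambda>z. z - d) ` \<gamma>)"
    unfolding inside_translation using d by (rule rev_image_eqI) simp
  ultimately show ?thesis by (simp only: Loop1_iff)
qed

text \<open>Subtracting d changes only the constant term of the Laurent expansion. That term is
  \<rho> times the coefficient of index 1, which therefore drops by d/\<rho>, while the leading
  coefficient stays.\<close>

lemma exterior_map_translation:
  assumes "exterior_map \<gamma> \<rho> \<phi>"
  shows "exterior_map ((\<lambda>z. z - d) ` \<gamma>) \<rho> (\<lambda>z. \<phi> z - d)"
proof -
  note e = assms[unfolded exterior_map_def]
  note \<rho> = conjunct1[OF e] and iso = conjunct1[OF conjunct2[OF e]]
  obtain b :: "nat \<Rightarrow> complex" where *: "\<forall>z. 1 < cmod z \<longrightarrow> summable (\<lambda>n. b (Suc n) * inverse z ^ Suc n) \<and>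
        \<phi> z = of_real \<rho> * z * (1 + (\<Sum>n. b (Suc n) * inverse z ^ Suc n))"
    using conjunct2[OF conjunct2[OF e]] ..
  note b = conjunct1[OF mp[OF spec[OF *]]] conjunct2[OF mp[OF spec[OF *]]]
  have "conformal_iso {z. 1 < cmod z} (outside ((\<lambda>z. z - d) ` \<gamma>)) (\<lambda>z. \<phi> z - d)"
    unfolding conformal_iso_def outside_translation
  proof
    show "(\<lambda>z. \<phi> z - d) holomorphic_on {z. 1 < cmod z}"
      using iso by (intro holomorphic_intros) (simp add: conformal_iso_def)
    have "bij_betw (\<lambda>z. z - d) (outside \<gamma>) ((\<lambda>z. z - d) ` outside \<gamma>)"
      by (intro inj_on_imp_bij_betw inj_onI) auto
    then have "bij_betw ((\<lambda>z. z - d) \<circ> \<phi>) {z. 1 < cmod z} ((\<lambda>z. z - d) ` outside \<gamma>)"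
      using iso by (intro bij_betw_trans) (auto simp: conformal_iso_def)
    then show "bij_betw (\<lambda>z. \<phi> z - d) {z. 1 < cmod z} ((\<lambda>z. z - d) ` outside \<gamma>)"
      by (simp add: o_def)
  qed
  moreover have "\<exists>b. \<forall>z. 1 < cmod z \<longrightarrow> summable (\<lambda>n. b (Suc n) * inverse z ^ Suc n) \<and>
        \<phi> z - d = of_real \<rho> * z * (1 + (\<Sum>n. b (Suc n) * inverse z ^ Suc n))"
  proof (intro exI[of _ "b(1 := b 1 - d / of_real \<rho>)"] allI impI)
    fix z :: complex assume z: "1 < cmod z"
    let ?b = "b(1 := b 1 - d / of_real \<rho>)"
    have eq: "(\<lambda>n. ?b (Suc n) * inverse z ^ Suc n) =
        (\<lambda>n. b (Suc n) * inverse z ^ Suc n - (if n = 0 then d / of_real \<rho> * inverse z else 0))"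
      by (auto simp: algebra_simps)
    have "(\<lambda>n. if n = 0 then d / of_real \<rho> * inverse z else 0) sums (d / of_real \<rho> * inverse z)"
      using sums_single[of 0 "\<lambda>_. d / of_real \<rho> * inverse z"] by simp
    then have "(\<lambda>n. ?b (Suc n) * inverse z ^ Suc n) sums
        ((\<Sum>n. b (Suc n) * inverse z ^ Suc n) - d / of_real \<rho> * inverse z)"
      unfolding eq by (intro sums_diff summable_sums b z)
    moreover have "z \<noteq> 0" using z by auto
    ultimately show "summable (\<lambda>n. ?b (Suc n) * inverse z ^ Suc n) \<and>
        \<phi> z - d = of_real \<rho> * z * (1 + (\<Sum>n. ?b (Suc n) * inverse z ^ Suc n))"
      using b(2)[OF z] \<rho> by (simp add: sums_iff field_simps)
  qed
  ultimately show ?thesis using \<rho> by (simp only: exterior_map_def simp_thms)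
qed

lemma loop_rho_inf_translation: "loop_rho_inf ((\<lambda>z. z - d) ` \<gamma>) = loop_rho_inf \<gamma>"
proof -
  have "(\<exists>\<phi>. exterior_map ((\<lambda>z. z - d) ` \<gamma>) \<rho> \<phi>) \<longleftrightarrow> (\<exists>\<phi>. exterior_map \<gamma> \<rho> \<phi>)" for \<rho>
  proof
    assume "\<exists>\<phi>. exterior_map ((\<lambda>z. z - d) ` \<gamma>) \<rho> \<phi>"
    then obtain \<phi> where "exterior_map ((\<lambda>z. z - d) ` \<gamma>) \<rho> \<phi>" by blast
    from exterior_map_translation[OF this, of "- d"] show "\<exists>\<phi>. exterior_map \<gamma> \<rho> \<phi>"
      by (auto simp: image_image)
  qed (use exterior_map_translation in blast)
  then show ?thesis by (simp add: loop_rho_inf_def)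
qed

section \<open>Conformal radius and change of base point\<close>

definition loop_psi :: "complex set \<Rightarrow> complex \<Rightarrow> complex" where
  "loop_psi \<gamma> = inv_into (ball 0 1) (loop_phi \<gamma>)"

text \<open>By the chain rule this is the modulus of the derivative at 0 of a Riemann map sending 0
  to x. Expressing it through the one map based at 0 lets all points x share a single
  parametrization.\<close>

definition conformal_radius :: "complex set \<Rightarrow> complex \<Rightarrow> real" where
  "conformal_radius \<gamma> x = cmod (deriv (loop_phi \<gamma>) (loop_psi \<gamma> x)) * (1 - (cmod (loop_psi \<gamma> x))\<^sup>2)"

lemma loop_psi_phi: "\<gamma> \<in> Loop1 \<Longrightarrow> cmod z < 1 \<Longrightarrow> loop_psi \<gamma> (loop_phi \<gamma> z) = z"
  unfolding loop_psi_def by (rule inv_into_f_f[OF inj_on_loop_phi]) auto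

text \<open>By the Schwarz lemma the Riemann maps based at \<open>0\<close> and at \<open>d\<close> differ by a disc automorphism
  exchanging the two base points.\<close>

lemma rebase_loop:
  assumes \<gamma>: "\<gamma> \<in> Loop1" and r: "r < 1" and d: "d \<in> loop_phi \<gamma> ` cball 0 r"
  defines "\<gamma>' \<equiv> (\<lambda>z. z - d) ` \<gamma>"
  shows "\<gamma>' \<in> Loop1" "- d \<in> loop_phi \<gamma>' ` cball 0 r" "conformal_radius \<gamma>' (- d) = loop_rho \<gamma>"
proof -
  let ?B = "ball 0 1 :: complex set"
  obtain z0 where z0: "cmod z0 \<le> r" "d = loop_phi \<gamma> z0" using d by auto
  then have z01: "cmod z0 < 1" using r by simp
  have "d \<in> inside \<gamma>"
    using z01 z0 loop_phi_image[OF \<gamma>] by auto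
  then show \<gamma>': "\<gamma>' \<in> Loop1" unfolding \<gamma>'_def by (rule Loop1_translation[OF \<gamma>])
  \<comment> \<open>The automorphism carries 0 to z0, so this map and the shifted
    \<open>loop_phi \<gamma>'\<close> are Riemann maps of the same domain with the same value d at
    0.\<close>
  have f: "conformal_iso ?B (inside \<gamma>) (loop_phi \<gamma> \<circ> Moebius_function 0 (- z0))"
    by (rule conformal_iso_compose[OF conformal_iso_Moebius conformal_iso_loop_phi[OF \<gamma>]]) (use z01 in simp)
  have "conformal_iso ?B ((\<lambda>z. z - d) ` inside \<gamma>) (loop_phi \<gamma>')"
    using conformal_iso_loop_phi[OF \<gamma>'] by (simp add: \<gamma>'_def inside_translation)
  moreover have "conformal_iso ((\<lambda>z. z - d) ` inside \<gamma>) (inside \<gamma>) (\<lambda>z. z + d)"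
    by (auto simp: conformal_iso_def intro!: holomorphic_intros bij_betw_byWitness[where f' = "\<lambda>z. z - d"])
  ultimately have g: "conformal_iso ?B (inside \<gamma>) ((\<lambda>z. z + d) \<circ> loop_phi \<gamma>')"
    by (rule conformal_iso_compose)
  have "(loop_phi \<gamma> \<circ> Moebius_function 0 (- z0)) 0 = ((\<lambda>z. z + d) \<circ> loop_phi \<gamma>') 0"
    using z0 loop_phi_0[OF \<gamma>'] by (simp add: Moebius_function_of_zero)
  from conformal_iso_disc_unique[OF f g this] obtain \<alpha> where \<alpha>: "cmod \<alpha> = 1"
    and eq: "\<And>z. z \<in> ?B \<Longrightarrow> loop_phi \<gamma> (Moebius_function 0 (- z0) z) = loop_phi \<gamma>' (\<alpha> * z) + d"
    by auto
  have eq': "loop_phi \<gamma> z = loop_phi \<gamma>' (\<alpha> * Moebius_function 0 z0 z) + d" if "z \<in> ?B" for z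
    using eq[of "Moebius_function 0 z0 z"] Moebius_function_compose[of "- z0" z0 z] z01 that
      Moebius_function_norm_lt_1[of z0 z 0] by simp
  \<comment> \<open>The parameter of -d for the translated loop. That |z1| = |z0| is the symmetry of
    hyperbolic distance: each base point lies in the other's disc of radius r.\<close>
  define z1 where "z1 = - \<alpha> * z0"
  have z1: "cmod z1 = cmod z0" using \<alpha> by (simp add: z1_def norm_mult)
  have M0: "\<alpha> * Moebius_function 0 z0 0 = z1" by (simp add: z1_def Moebius_function_of_zero)
  have p1: "loop_phi \<gamma>' z1 = - d"
    using eq'[of 0] loop_phi_0[OF \<gamma>] M0 by (simp add: eq_neg_iff_add_eq_0)
  then show "- d \<in> loop_phi \<gamma>' ` cball 0 r"
    using z1 z0 by (intro image_eqI[of _ _ z1]) auto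
  have psi: "loop_psi \<gamma>' (- d) = z1"
    using loop_psi_phi[OF \<gamma>', of z1] p1 z1 z01 by simp
  \<comment> \<open>Differentiating \<open>eq'\<close> at 0 gives \<open>loop_rho \<gamma>\<close>
    on one side and the conformal radius at -d on the other, up to the unimodular \<alpha>.\<close>
  have "(loop_phi \<gamma>' has_field_derivative deriv (loop_phi \<gamma>') z1) (at z1)"
    by (rule holomorphic_derivI[OF loop_phi_holomorphic[OF \<gamma>']]) (use z1 z01 in auto)
  then have "((\<lambda>z. loop_phi \<gamma>' (\<alpha> * Moebius_function 0 z0 z)) has_field_derivative
      deriv (loop_phi \<gamma>') z1 * (\<alpha> * (1 - (cmod z0)\<^sup>2))) (at 0)"
    using M0 by (intro DERIV_chain2[where f = "loop_phi \<gamma>'"] DERIV_cmult has_field_derivative_Moebius_0) simp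
  then have "((\<lambda>z. loop_phi \<gamma>' (\<alpha> * Moebius_function 0 z0 z) + d) has_field_derivative
      deriv (loop_phi \<gamma>') z1 * (\<alpha> * (1 - (cmod z0)\<^sup>2))) (at 0)"
    by (auto intro!: derivative_eq_intros)
  then have "(loop_phi \<gamma> has_field_derivative deriv (loop_phi \<gamma>') z1 * (\<alpha> * (1 - (cmod z0)\<^sup>2))) (at 0)"
    by (rule has_field_derivative_transform_within_open[where S = ?B]) (use eq' in auto)
  then have "of_real (loop_rho \<gamma>) = deriv (loop_phi \<gamma>') z1 * (\<alpha> * of_real (1 - (cmod z0)\<^sup>2))"
    using deriv_loop_phi_0[OF \<gamma>] by (simp add: DERIV_imp_deriv)
  from arg_cong[OF this, of cmod]
  have "loop_rho \<gamma> = cmod (deriv (loop_phi \<gamma>') z1) * \<bar>1 - (cmod z0)\<^sup>2\<bar>"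
    using \<alpha> loop_rho_pos[OF \<gamma>] by (simp only: norm_mult norm_of_real)
  moreover have "(cmod z0)\<^sup>2 < 1" using z01 by (simp add: abs_square_less_1)
  ultimately show "conformal_radius \<gamma>' (- d) = loop_rho \<gamma>"
    by (simp add: conformal_radius_def psi z1)
qed

section \<open>The Vietoris topology and conformal restriction\<close>

lemma Loop_subset_topspace: "\<gamma> \<in> Loop X \<Longrightarrow> \<gamma> \<subseteq> topspace X"
  by (auto simp: Loop_def compactin_def)

lemma topspace_vietoris: "topspace (vietoris X) = Loop X"
proof -
  have "Loop X \<in> {{\<gamma> \<in> Loop X. \<gamma> \<subseteq> U} | U. openin X U}"
    using Loop_subset_topspace by (intro CollectI exI[of _ "topspace X"]) auto
  then show ?thesis
    unfolding vietoris_def topology_generated_by_topspace by blast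
qed

lemma openin_vietoris_subset: "openin X U \<Longrightarrow> openin (vietoris X) {\<gamma> \<in> Loop X. \<gamma> \<subseteq> U}"
  unfolding vietoris_def by (intro topology_generated_by_Basis UnI1) blast

lemma space_borel_of: "space (borel_of X) = topspace X"
  unfolding borel_of_def by (rule space_measure_of) (auto dest: openin_subset)

lemma sets_borel_of: "sets (borel_of X) = sigma_sets (topspace X) {U. openin X U}"
  unfolding borel_of_def by (rule sets_measure_of) (auto dest: openin_subset)

lemma openin_imp_sets_borel_of: "openin X U \<Longrightarrow> U \<in> sets (borel_of X)"
  by (auto simp: sets_borel_of)

lemma continuous_map_measurable_borel_of:
  assumes "continuous_map X Y f"
  shows "f \<in> borel_of X \<rightarrow>\<^sub>M borel_of Y"
  unfolding borel_of_def[of Y]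
proof (rule measurable_measure_of)
  show "f \<in> space (borel_of X) \<rightarrow> topspace Y"
    using assms by (auto simp: space_borel_of continuous_map_def)
  fix U assume "U \<in> {U. openin Y U}"
  then have "openin X {x \<in> topspace X. f x \<in> U}"
    using assms by (simp add: continuous_map_def)
  moreover have "f -` U \<inter> space (borel_of X) = {x \<in> topspace X. f x \<in> U}"
    by (auto simp: space_borel_of)
  ultimately show "f -` U \<inter> space (borel_of X) \<in> sets (borel_of X)"
    by (simp add: openin_imp_sets_borel_of)
qed (auto dest: openin_subset)

lemma Loop_translation:
  fixes c :: complex
  assumes "\<gamma> \<in> Loop (top_of_set D)" "(\<lambda>z. z - c) ` D \<subseteq> E"
  shows "(\<lambda>z. z - c) ` \<gamma> \<in> Loop (top_of_set E)"
  unfolding Loop_top_of_set_iff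
proof (intro conjI)
  note \<gamma> = assms(1)[unfolded Loop_top_of_set_iff]
  show "(\<lambda>z. z - c) ` \<gamma> \<subseteq> E" using \<gamma> assms(2) by blast
  show "compact ((\<lambda>z. z - c) ` \<gamma>)" by (rule compact_translation_subtract) (use \<gamma> in blast)
  show "(\<lambda>z. z - c) ` \<gamma> homeomorphic sphere (0::complex) 1"
    using \<gamma> by (simp only: homeomorphic_circle_translation)
qed

text \<open>The preimage of a generator of either kind is the generator of the same kind for the
  pulled back open set.\<close>

lemma continuous_map_vietoris_translation:
  fixes c :: complex
  assumes DE: "(\<lambda>z. z - c) ` D \<subseteq> E"
  shows "continuous_map (vietoris (top_of_set D)) (vietoris (top_of_set E)) (\<lambda>\<gamma>. (\<lambda>z. z - c) ` \<gamma>)"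
  unfolding vietoris_def[of "top_of_set E"]
proof (rule continuous_on_generated_topo)
  let ?f = "\<lambda>z. z - c" and ?X = "top_of_set D" and ?Y = "top_of_set E"
  let ?S = "{{\<gamma> \<in> Loop ?Y. \<gamma> \<subseteq> U} | U. openin ?Y U} \<union> {{\<gamma> \<in> Loop ?Y. \<gamma> \<inter> U \<noteq> {}} | U. openin ?Y U}"
  have "Loop ?Y = \<Union>?S"
    using topspace_vietoris[of ?Y] unfolding vietoris_def topology_generated_by_topspace by (rule sym)
  then show "(\<lambda>\<gamma>. ?f ` \<gamma>) ` topspace (vietoris ?X) \<subseteq> \<Union>?S"
    using Loop_translation[OF _ DE] by (auto simp: topspace_vietoris)
  fix W assume "W \<in> ?S"
  then obtain U where U: "openin ?Y U" and W: "W = {\<gamma> \<in> Loop ?Y. \<gamma> \<subseteq> U} \<or> W = {\<gamma> \<in> Loop ?Y. \<gamma> \<inter> U \<noteq> {}}"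
    by blast
  define V where "V = {z \<in> D. z - c \<in> U}"
  have "continuous_map ?X ?Y ?f"
    using DE by (auto simp: continuous_map_in_subtopology intro!: continuous_intros)
  then have V: "openin ?X V"
    using U by (auto simp: continuous_map_def V_def)
  have "(\<lambda>\<gamma>. ?f ` \<gamma>) -` {\<gamma> \<in> Loop ?Y. \<gamma> \<subseteq> U} \<inter> Loop ?X = {\<gamma> \<in> Loop ?X. \<gamma> \<subseteq> V}"
    using Loop_translation[OF _ DE] Loop_subset_topspace[of _ ?X] by (auto simp: V_def image_subset_iff)
  moreover have "(\<lambda>\<gamma>. ?f ` \<gamma>) -` {\<gamma> \<in> Loop ?Y. \<gamma> \<inter> U \<noteq> {}} \<inter> Loop ?X = {\<gamma> \<in> Loop ?X. \<gamma> \<inter> V \<noteq> {}}"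
    using Loop_translation[OF _ DE] Loop_subset_topspace[of _ ?X] by (fastforce simp: V_def)
  moreover have "openin (vietoris ?X) {\<gamma> \<in> Loop ?X. \<gamma> \<subseteq> V}" "openin (vietoris ?X) {\<gamma> \<in> Loop ?X. \<gamma> \<inter> V \<noteq> {}}"
    using V unfolding vietoris_def by (blast intro: topology_generated_by_Basis)+
  ultimately show "openin (vietoris ?X) ((\<lambda>\<gamma>. ?f ` \<gamma>) -` W \<inter> topspace (vietoris ?X))"
    using W by (auto simp: topspace_vietoris)
qed

lemma riemann_surface_plane:
  assumes "open D" "connected D" "D \<noteq> {}"
  shows "riemann_surface (plane_surface D)"
proof -
  have "homeomorphic_map (top_of_set D) (top_of_set D) (\<lambda>z. z)"
    by (simp add: homeomorphic_map_id[unfolded id_def])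
  moreover have "((\<lambda>z. z) \<circ> inv_into D (\<lambda>z. z)) holomorphic_on D"
    by (rule holomorphic_transform[of "\<lambda>z. z"]) (auto simp: inv_into_f_f[of "\<lambda>z. z", simplified])
  moreover have "Hausdorff_space (top_of_set D)"
    by (intro Hausdorff_space_subtopology) auto
  ultimately show ?thesis
    unfolding riemann_surface_def plane_surface_def
    using assms by (simp add: connected_space_subtopology subtopology_subtopology)
qed

lemma conformal_embedding_translation:
  assumes "(\<lambda>z. z - c) ` D \<subseteq> E"
  shows "conformal_embedding (plane_surface D) (plane_surface E) (\<lambda>z. z - c)"
proof -
  have "continuous_map (top_of_set D) (top_of_set E) (\<lambda>z. z - c)"
    using assms by (auto simp: continuous_map_in_subtopology intro!: continuous_intros)
  moreover have "((\<lambda>z. z) \<circ> (\<lambda>z. z - c) \<circ> inv_into D (\<lambda>z. z)) holomorphic_on (\<lambda>z. z) ` (D \<inter> (\<lambda>z. z - c) -` E)"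
    by (rule holomorphic_transform[of "\<lambda>z. z - c"])
      (auto intro!: holomorphic_intros simp: inv_into_f_f[of "\<lambda>z. z", simplified])
  ultimately show ?thesis
    unfolding conformal_embedding_def plane_surface_def by (auto simp: inj_on_def)
qed

text \<open>A point outside \<gamma> is joined by a path off \<gamma> to a point y beyond a ball
  containing \<gamma>. Every loop in that ball that misses the path leaves p outside as well, and
  the path is closed, so these loops form a Vietoris neighbourhood of \<gamma>.\<close>

lemma openin_vietoris_outside:
  "openin (vietoris (top_of_set D)) {\<gamma> \<in> Loop (top_of_set D). p \<in> outside \<gamma>}" for p :: complex
proof (subst openin_subopen, intro ballI)
  let ?X = "top_of_set D"
  fix \<gamma> assume "\<gamma> \<in> {\<gamma> \<in> Loop ?X. p \<in> outside \<gamma>}"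
  then have \<gamma>: "\<gamma> \<in> Loop ?X" "\<gamma> \<subseteq> D" "compact \<gamma>" and p: "p \<in> outside \<gamma>"
    by (auto simp: Loop_top_of_set_iff)
  obtain s where s: "\<gamma> \<subseteq> ball 0 s"
    using bounded_subset_ballD[OF compact_imp_bounded[OF \<gamma>(3)]] by blast
  obtain y where y: "s \<le> cmod y" "connected_component (- \<gamma>) p y"
    using p unfolding outside_connected_component_le by blast
  have "open (- \<gamma>)" using \<gamma> by (simp add: compact_imp_closed open_Compl)
  then have "path_component (- \<gamma>) p y"
    using y(2) by (simp add: open_path_connected_component)
  then obtain g where g: "path g" "path_image g \<subseteq> - \<gamma>" "pathstart g = p" "pathfinish g = y"
    by (auto simp: path_component_def)
  let ?U = "D \<inter> (ball 0 s - path_image g)"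
  have U: "openin ?X ?U"
    using closed_path_image[OF g(1)] by (intro openin_open_Int open_Diff) auto
  have "\<gamma>' \<in> {\<gamma> \<in> Loop ?X. p \<in> outside \<gamma>}" if "\<gamma>' \<in> Loop ?X" "\<gamma>' \<subseteq> ?U" for \<gamma>'
  proof -
    have "- ball 0 s \<subseteq> outside \<gamma>'"
      by (rule outside_subset_convex) (use that in auto)
    then have "y \<in> outside \<gamma>'" using y by auto
    moreover have "connected_component (- \<gamma>') y p"
      unfolding connected_component_def
      using g that connected_path_image[OF g(1)] pathstart_in_path_image[of g] pathfinish_in_path_image[of g]
      by (intro exI[of _ "path_image g"]) auto
    ultimately show ?thesis using outside_same_component that by blast
  qed
  then show "\<exists>T. openin (vietoris ?X) T \<and> \<gamma> \<in> T \<and> T \<subseteq> {\<gamma> \<in> Loop ?X. p \<in> outside \<gamma>}"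
    using \<gamma> s g by (intro exI[of _ "{\<gamma> \<in> Loop ?X. \<gamma> \<subseteq> ?U}"] conjI openin_vietoris_subset[OF U]) auto
qed

text \<open>\<open>distr\<close> is built by \<open>measure_of\<close>, which returns the null
  measure when the prescribed set function is not a measure. Nonzero mass thus certifies that the
  naive pushforward formula is additive, and a set with nonmeasurable preimage, together with its
  complement, would then make the total mass 0.\<close>

lemma measurable_if_distr_nontrivial:
  assumes f: "f \<in> space M \<rightarrow> space N" and nz: "emeasure (distr M N f) (space N) \<noteq> 0"
  shows "f \<in> M \<rightarrow>\<^sub>M N"
proof (rule measurableI)
  let ?m = "\<lambda>A. emeasure M (f -` A \<inter> space M)"
  have "measure_space (space N) (sigma_sets (space N) (sets N)) ?m"
    using nz unfolding distr_def by (subst (asm) emeasure_measure_of_conv) (auto split: if_splits)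
  then have em: "emeasure (distr M N f) A = ?m A" if "A \<in> sets N" for A
    using that unfolding distr_def by (subst emeasure_measure_of_conv) (simp add: sets.sigma_sets_eq)
  fix A assume A: "A \<in> sets N"
  show "f -` A \<inter> space M \<in> sets M"
  proof (rule ccontr)
    assume n: "f -` A \<inter> space M \<notin> sets M"
    have c: "f -` A \<inter> space M = space M - f -` (space N - A) \<inter> space M"
      using f by auto
    then have n': "f -` (space N - A) \<inter> space M \<notin> sets M"
      using n by (metis sets.compl_sets)
    have "emeasure (distr M N f) (space N) = emeasure (distr M N f) (A \<union> (space N - A))"
      using sets.sets_into_space[OF A] by (simp add: Un_absorb1)
    also have "\<dots> = emeasure (distr M N f) A + emeasure (distr M N f) (space N - A)"
      using A by (intro plus_emeasure[symmetric]) auto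
    also have "\<dots> = 0" using A n n' by (simp add: em emeasure_notin_sets)
    finally show False using nz by simp
  qed
qed (use f in auto)

text \<open>Each derivative is a limit of difference quotients along a fixed sequence of increments,
  so measurability of all evaluations passes from one order to the next.\<close>

lemma borel_measurable_higher_deriv:
  fixes f :: "'a \<Rightarrow> complex \<Rightarrow> complex"
  assumes hol: "\<And>x. x \<in> space M \<Longrightarrow> f x holomorphic_on S" and S: "open S"
    and meas: "\<And>z. z \<in> S \<Longrightarrow> (\<lambda>x. f x z) \<in> borel_measurable M" and z: "z \<in> S"
  shows "(\<lambda>x. (deriv ^^ k) (f x) z) \<in> borel_measurable M"
  using z
proof (induction k arbitrary: z)
  case 0
  then show ?case using meas by simp
next
  case (Suc k)
  obtain e where e: "e > 0" "ball z e \<subseteq> S" using S Suc.prems openE by blast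
  \<comment> \<open>Half the radius e is the largest increment, which keeps every z + h m in the
    ball inside S.\<close>
  define h where "h m = complex_of_real (e / 2 / real (Suc m))" for m :: nat
  have h0: "h m \<noteq> 0" for m unfolding h_def of_real_eq_0_iff using e by simp
  have hS: "z + h m \<in> S" for m
  proof -
    have "e / 2 / real (Suc m) \<le> e / 2 / 1"
      by (rule divide_left_mono) (use e in auto)
    moreover have "cmod (h m) = e / 2 / real (Suc m)"
      unfolding h_def norm_of_real using e by (intro abs_of_nonneg) auto
    ultimately have "cmod (h m) \<le> e / 2" by simp
    then show ?thesis using e by (intro subsetD[OF e(2)]) (simp add: dist_norm)
  qed
  have hlim: "h \<longlonglongrightarrow> 0"
    unfolding h_def by (rule tendsto_of_real[where a = 0, simplified]) real_asymp
  show ?case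
  proof (rule borel_measurable_LIMSEQ_metric)
    show "(\<lambda>x. ((deriv ^^ k) (f x) (z + h m) - (deriv ^^ k) (f x) z) / h m) \<in> borel_measurable M" for m
      using Suc.IH[OF hS] Suc.IH[OF Suc.prems] by measurable
    fix x assume x: "x \<in> space M"
    have "(deriv ^^ k) (f x) holomorphic_on S"
      by (rule holomorphic_higher_deriv[OF hol[OF x] S])
    then have "((deriv ^^ k) (f x) has_field_derivative deriv ((deriv ^^ k) (f x)) z) (at z)"
      using S Suc.prems by (rule holomorphic_derivI)
    then have "((\<lambda>h. ((deriv ^^ k) (f x) (z + h) - (deriv ^^ k) (f x) z) / h) \<longlongrightarrow> deriv ((deriv ^^ k) (f x)) z) (at 0)"
      by (simp add: DERIV_def)
    moreover have "filterlim h (at 0) sequentially"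
      by (simp add: filterlim_at hlim h0)
    ultimately have "(\<lambda>m. ((deriv ^^ k) (f x) (z + h m) - (deriv ^^ k) (f x) z) / h m) \<longlonglongrightarrow> deriv ((deriv ^^ k) (f x)) z"
      by (rule filterlim_compose)
    then show "(\<lambda>m. ((deriv ^^ k) (f x) (z + h m) - (deriv ^^ k) (f x) z) / h m) \<longlonglongrightarrow> (deriv ^^ Suc k) (f x) z"
      by (simp only: funpow.simps o_apply)
  qed
qed

section \<open>Translations of the loop measure and the truncated probability measure\<close>

locale werner_measure =
  fixes \<mu> :: "complex surface \<Rightarrow> complex set measure" and \<nu> :: "(complex \<Rightarrow> complex) measure"
  assumes restr: "conformal_restriction \<mu>" and disint: "is_\<nu>\<^sub>0 \<mu> \<nu>" and prob: "prob_space \<nu>"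
begin

sublocale nu: prob_space \<nu> by (rule prob)

abbreviation "M \<equiv> \<mu> (plane_surface (- {0}))"

lemma
  assumes "open D" "connected D" "D \<noteq> {}"
  shows sets_mu: "sets (\<mu> (plane_surface D)) = sets (borel_of (vietoris (top_of_set D)))"
    and space_mu: "space (\<mu> (plane_surface D)) = Loop (top_of_set D)"
proof -
  show "sets (\<mu> (plane_surface D)) = sets (borel_of (vietoris (top_of_set D)))"
    using restr riemann_surface_plane[OF assms] unfolding conformal_restriction_def
    by (simp add: plane_surface_def)
  from sets_eq_imp_space_eq[OF this] show "space (\<mu> (plane_surface D)) = Loop (top_of_set D)"
    by (simp add: space_borel_of topspace_vietoris)
qed

text \<open>Conformal restriction for integrals. By injectivity the image of the preimage of A
  consists of the loops of A lying in the translate of D, so the pushed measure is the measure on E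
  with the indicator of those loops as density.\<close>

lemma nn_integral_translation:
  fixes c :: complex
  assumes D: "open D" "connected D" "D \<noteq> {}" and E: "open E" "connected E" "E \<noteq> {}"
    and DE: "(\<lambda>z. z - c) ` D \<subseteq> E"
    and F[measurable]: "F \<in> borel_measurable (\<mu> (plane_surface E))"
  shows "(\<integral>\<^sup>+\<gamma>. F ((\<lambda>z. z - c) ` \<gamma>) \<partial>\<mu> (plane_surface D)) =
    (\<integral>\<^sup>+\<gamma>. F \<gamma> * indicator {\<gamma>. \<gamma> \<subseteq> (\<lambda>z. z - c) ` D} \<gamma> \<partial>\<mu> (plane_surface E))"
proof -
  let ?f = "\<lambda>\<gamma>. (\<lambda>z. z - c) ` \<gamma>" and ?MD = "\<mu> (plane_surface D)" and ?ME = "\<mu> (plane_surface E)"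
  let ?I = "{\<gamma> \<in> Loop (top_of_set E). \<gamma> \<subseteq> (\<lambda>z. z - c) ` D}"
  have f[measurable]: "?f \<in> ?MD \<rightarrow>\<^sub>M ?ME"
    using continuous_map_measurable_borel_of[OF continuous_map_vietoris_translation[OF DE]]
    by (simp add: sets_mu[OF D] sets_mu[OF E] cong: measurable_cong_sets)
  have "open ((\<lambda>z. z - c) ` D)" using D(1) by (rule open_translation_subtract)
  then have "openin (top_of_set E) ((\<lambda>z. z - c) ` D)"
    using DE by (metis openin_open_Int Int_absorb1)
  then have I[measurable]: "?I \<in> sets ?ME"
    unfolding sets_mu[OF E] by (intro openin_imp_sets_borel_of openin_vietoris_subset)
  have "distr ?MD ?ME ?f = density ?ME (indicator ?I)"
  proof (rule measure_eqI)
    fix A assume "A \<in> sets (distr ?MD ?ME ?f)"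
    then have A[measurable]: "A \<in> sets ?ME" by simp
    have B: "?f -` A \<inter> space ?MD \<in> sets ?MD" by (rule measurable_sets[OF f A])
    have "emeasure (distr ?MD ?ME ?f) A = emeasure ?MD (?f -` A \<inter> space ?MD)"
      by (rule emeasure_distr[OF f A])
    also have "\<dots> = emeasure ?ME (?f ` (?f -` A \<inter> space ?MD))"
      using restr riemann_surface_plane[OF D] riemann_surface_plane[OF E]
        conformal_embedding_translation[OF DE] B
      unfolding conformal_restriction_def by metis
    also have "?f ` (?f -` A \<inter> space ?MD) = ?I \<inter> A"
    proof (intro equalityI subsetI)
      fix \<gamma> assume "\<gamma> \<in> ?f ` (?f -` A \<inter> space ?MD)"
      then show "\<gamma> \<in> ?I \<inter> A"
        using Loop_translation[OF _ DE] Loop_subset_topspace[of _ "top_of_set D"]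
        by (auto simp: space_mu[OF D])
    next
      fix \<gamma> assume \<gamma>: "\<gamma> \<in> ?I \<inter> A"
      define \<gamma>' where "\<gamma>' = (\<lambda>z. z - - c) ` \<gamma>"
      have "\<gamma>' \<subseteq> D" using \<gamma> by (auto simp: \<gamma>'_def)
      \<comment> \<open>Translating back may carry E out of D, so the loop is first placed in the
        whole plane and then returned to D by the inclusion just shown.\<close>
      moreover have "\<gamma>' \<in> Loop (top_of_set UNIV)"
        unfolding \<gamma>'_def by (rule Loop_translation[where D = E]) (use \<gamma> in auto)
      ultimately have "\<gamma>' \<in> Loop (top_of_set D)" by (simp only: Loop_top_of_set_iff simp_thms)
      moreover have e: "?f \<gamma>' = \<gamma>" by (simp add: \<gamma>'_def image_image)
      ultimately show "\<gamma> \<in> ?f ` (?f -` A \<inter> space ?MD)"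
        using \<gamma> by (intro image_eqI[of _ _ \<gamma>']) (auto simp: space_mu[OF D])
    qed
    also have "emeasure ?ME (?I \<inter> A) = emeasure (density ?ME (indicator ?I)) A"
      by (subst emeasure_density) (auto simp flip: indicator_inter_arith)
    finally show "emeasure (distr ?MD ?ME ?f) A = emeasure (density ?ME (indicator ?I)) A" .
  qed simp
  then have "(\<integral>\<^sup>+\<gamma>. F \<gamma> \<partial>distr ?MD ?ME ?f) = (\<integral>\<^sup>+\<gamma>. F \<gamma> \<partial>density ?ME (indicator ?I))" by simp
  then have "(\<integral>\<^sup>+\<gamma>. F (?f \<gamma>) \<partial>?MD) = (\<integral>\<^sup>+\<gamma>. indicator ?I \<gamma> * F \<gamma> \<partial>?ME)"
    by (simp add: nn_integral_distr nn_integral_density)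
  also have "\<dots> = (\<integral>\<^sup>+\<gamma>. F \<gamma> * indicator {\<gamma>. \<gamma> \<subseteq> (\<lambda>z. z - c) ` D} \<gamma> \<partial>?ME)"
    by (intro nn_integral_cong) (auto simp: space_mu[OF E] indicator_def)
  finally show ?thesis .
qed

text \<open>The points may coincide: d = 0 supplies the once punctured plane.\<close>

lemma twice_punctured_plane:
  "open (- {0, d::complex})" "connected (- {0, d::complex})" "- {0, d::complex} \<noteq> {}"
proof -
  show "open (- {0, d})" by (intro open_Compl finite_imp_closed) simp
  have "infinite (- {0, d})"
    by (rule infinite_UNIV_char_0[THEN Diff_infinite_finite[rotated], folded Compl_eq_Diff_UNIV]) simp
  then show "- {0, d} \<noteq> {}" by (metis finite.emptyI)
  have "connected (UNIV - {0, d})"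
    by (rule connected_open_diff_countable) (simp_all add: connected_UNIV)
  then show "connected (- {0, d})"
    by (simp only: Compl_eq_Diff_UNIV)
qed

lemmas punctured_plane = twice_punctured_plane[of 0, unfolded insert_absorb2]

text \<open>A loop avoiding 0 has it either inside or outside, and the second condition is Vietoris
  open.\<close>

lemma sets_Loop1: "Loop1 \<in> sets M"
proof -
  have "Loop1 = Loop (top_of_set (- {0})) - {\<gamma> \<in> Loop (top_of_set (- {0})). 0 \<in> outside \<gamma>}"
    using inside_Un_outside inside_Int_outside
    by (fastforce simp: Loop1_def surrounds_zero_def Loop_top_of_set_iff)
  also have "\<dots> \<in> sets M"
  proof (rule sets.Diff)
    show "Loop (top_of_set (- {0})) \<in> sets M"
      using sets.top[of M] by (simp add: space_mu[OF punctured_plane])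
    show "{\<gamma> \<in> Loop (top_of_set (- {0})). 0 \<in> outside \<gamma>} \<in> sets M"
      unfolding sets_mu[OF punctured_plane]
      by (intro openin_imp_sets_borel_of openin_vietoris_outside)
  qed
  finally show ?thesis .
qed

lemma Loop1_subset_space: "Loop1 \<subseteq> space M"
  using sets.sets_into_space[OF sets_Loop1] .

lemma space_mu0: "space (\<mu>\<^sub>0 \<mu>) = Loop1"
  using Loop1_subset_space by (simp add: \<mu>\<^sub>0_def space_restrict_space Int_absorb2)

text \<open>The window ends at e because ln e - ln 1 = 1; this makes \<open>trunc\<close> a
  probability measure.\<close>

lemma emeasure_log_measure: "emeasure log_measure {1..exp 1} = 1"
proof -
  have "emeasure log_measure {1..exp 1} = (\<integral>\<^sup>+\<rho>. ennreal (1 / \<rho>) * indicator {1..exp 1} \<rho> \<partial>lborel)"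
    unfolding log_measure_def
    by (subst emeasure_density) (auto intro!: nn_integral_cong simp: indicator_def)
  also have "\<dots> = ennreal (ln (exp 1) - ln 1)"
    by (rule nn_integral_FTC_Icc) (auto intro!: derivative_eq_intros simp: divide_simps)
  finally show ?thesis by simp
qed

sublocale log: sigma_finite_measure log_measure
proof -
  have "AE \<rho> in lborel. indicator {0<..} \<rho> * ennreal (1 / \<rho>) \<noteq> \<infinity>"
    by (intro AE_I2) (auto simp: indicator_def)
  then show "sigma_finite_measure log_measure"
    unfolding log_measure_def
    by (subst sigma_finite_measure.sigma_finite_iff_density_finite[OF sigma_finite_lborel]) auto
qed

lemma sets_log_measure[measurable_cong, simp]: "sets log_measure = sets borel"
  by (simp add: log_measure_def)

lemma sets_nu[measurable_cong, simp]: "sets \<nu> = sets u_space"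
  using disint by (simp add: is_\<nu>\<^sub>0_def)

abbreviation "coord \<equiv> \<lambda>\<gamma>. (loop_u \<gamma>, loop_rho_inf \<gamma>)"

lemma distr_coord: "distr (\<mu>\<^sub>0 \<mu>) (u_space \<Otimes>\<^sub>M borel) coord = \<nu> \<Otimes>\<^sub>M log_measure"
  using disint by (simp add: is_\<nu>\<^sub>0_def)

text \<open>The pushforward has infinite mass, which forces the measurability of the coordinates: if the
  preimage of a set is not measurable, neither is that of its complement, and both have measure
  \<open>0\<close> by convention.\<close>

lemma measurable_coord: "coord \<in> \<mu>\<^sub>0 \<mu> \<rightarrow>\<^sub>M (u_space \<Otimes>\<^sub>M borel)"
proof (rule measurable_if_distr_nontrivial)
  show "coord \<in> space (\<mu>\<^sub>0 \<mu>) \<rightarrow> space (u_space \<Otimes>\<^sub>M borel)"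
    by (auto simp: space_mu0 space_pair_measure u_space_def space_restrict_space)
  have "emeasure (\<nu> \<Otimes>\<^sub>M log_measure) (space \<nu> \<times> {1..exp 1}) = emeasure \<nu> (space \<nu>) * emeasure log_measure {1..exp 1}"
    by (rule log.emeasure_pair_measure_Times) (auto simp del: sets_nu)
  also have "\<dots> = 1" by (simp add: emeasure_log_measure nu.emeasure_space_1)
  finally have "emeasure (\<nu> \<Otimes>\<^sub>M log_measure) (space (\<nu> \<Otimes>\<^sub>M log_measure)) \<noteq> 0"
    using emeasure_space[of "\<nu> \<Otimes>\<^sub>M log_measure" "space \<nu> \<times> {1..exp 1}"] by auto
  then show "emeasure (distr (\<mu>\<^sub>0 \<mu>) (u_space \<Otimes>\<^sub>M borel) coord) (space (u_space \<Otimes>\<^sub>M borel)) \<noteq> 0"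
    unfolding distr_coord
    by (simp add: space_pair_measure sets_eq_imp_space_eq[OF sets_nu] sets_eq_imp_space_eq[OF sets_log_measure])
qed

lemma measurable_loop_u_space[measurable]: "loop_u \<in> \<mu>\<^sub>0 \<mu> \<rightarrow>\<^sub>M u_space"
  using measurable_compose[OF measurable_coord measurable_fst] by simp

lemma measurable_loop_rho_inf[measurable]: "loop_rho_inf \<in> borel_measurable (\<mu>\<^sub>0 \<mu>)"
  using measurable_compose[OF measurable_coord measurable_snd] by simp

definition "cutoff \<gamma> = (indicator {1..exp 1} (loop_rho_inf \<gamma>) :: ennreal)"

lemma measurable_cutoff[measurable]: "cutoff \<in> borel_measurable (\<mu>\<^sub>0 \<mu>)"
  unfolding cutoff_def[abs_def] by measurable

lemma cutoff_translation: "cutoff ((\<lambda>z. z - d) ` \<gamma>) = cutoff \<gamma>"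
  by (simp add: cutoff_def loop_rho_inf_translation)

definition "trunc = density (\<mu>\<^sub>0 \<mu>) cutoff"

lemma sets_trunc[measurable_cong, simp]: "sets trunc = sets (\<mu>\<^sub>0 \<mu>)" and space_trunc: "space trunc = Loop1"
  by (simp_all add: trunc_def space_mu0)

text \<open>In the product coordinates the cutoff sees only the second factor, which integrates to 1
  and leaves \<open>\<nu>\<close>.\<close>

lemma nn_integral_trunc_u:
  assumes [measurable]: "g \<in> borel_measurable u_space"
  shows "(\<integral>\<^sup>+\<gamma>. g (loop_u \<gamma>) \<partial>trunc) = (\<integral>\<^sup>+u. g u \<partial>\<nu>)"
proof -
  let ?g = "\<lambda>p. g (fst p) * (indicator {1..exp 1} (snd p) :: ennreal)"
  have "(\<integral>\<^sup>+\<gamma>. g (loop_u \<gamma>) \<partial>trunc) = (\<integral>\<^sup>+\<gamma>. ?g (coord \<gamma>) \<partial>\<mu>\<^sub>0 \<mu>)"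
    unfolding trunc_def by (subst nn_integral_density) (auto simp: cutoff_def mult.commute)
  also have "\<dots> = (\<integral>\<^sup>+p. ?g p \<partial>distr (\<mu>\<^sub>0 \<mu>) (u_space \<Otimes>\<^sub>M borel) coord)"
    by (rule nn_integral_distr[symmetric]) (use measurable_coord in auto)
  also have "\<dots> = (\<integral>\<^sup>+u. (\<integral>\<^sup>+\<rho>. g u * indicator {1..exp 1} \<rho> \<partial>log_measure) \<partial>\<nu>)"
    unfolding distr_coord by (subst log.nn_integral_fst[symmetric]) auto
  also have "\<dots> = (\<integral>\<^sup>+u. g u \<partial>\<nu>)"
    by (intro nn_integral_cong) (simp add: nn_integral_cmult_indicator emeasure_log_measure)
  finally show ?thesis .
qed

lemma prob_space_trunc: "prob_space trunc"
proof
  have "emeasure trunc (space trunc) = (\<integral>\<^sup>+\<gamma>. 1 \<partial>trunc)" by simp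
  also have "\<dots> = (\<integral>\<^sup>+u. 1 \<partial>\<nu>)" by (rule nn_integral_trunc_u) simp
  finally show "emeasure trunc (space trunc) = 1" by (simp add: nu.emeasure_space_1)
qed

lemma measurable_eval_u_space: "(\<lambda>u. u z) \<in> borel_measurable u_space"
  unfolding u_space_def
  by (intro measurable_restrict_space1 borel_measurable_continuous_onI continuous_on_product_coordinates)

lemma measurable_loop_u_eval[measurable]: "(\<lambda>\<gamma>. loop_u \<gamma> z) \<in> borel_measurable (\<mu>\<^sub>0 \<mu>)"
  by (rule measurable_compose[OF measurable_loop_u_space measurable_eval_u_space])

lemma measurable_u_coeff[measurable]: "u_coeff n \<in> borel_measurable u_space"
proof -
  have "(\<lambda>u. (deriv ^^ Suc n) u 0) \<in> borel_measurable u_space"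
    by (rule borel_measurable_higher_deriv[where S = "ball 0 1"])
      (auto simp: u_space_def space_restrict_space loop_u_holomorphic measurable_eval_u_space[unfolded u_space_def] simp del: funpow.simps)
  then show ?thesis unfolding u_coeff_def[abs_def] by measurable
qed

lemma measurable_u_coeff_loop[measurable]: "(\<lambda>\<gamma>. u_coeff n (loop_u \<gamma>)) \<in> borel_measurable (\<mu>\<^sub>0 \<mu>)"
  by (rule measurable_compose[OF measurable_loop_u_space measurable_u_coeff])

end

section \<open>Measurability in the loop and in the point\<close>

text \<open>\<open>u_coeff n\<close> belongs to the power n + 1 of u, hence the factor n + 1 at the
  power n of u'. The term n = 0 is the normalization u'(0) = 1.\<close>

lemma deriv_loop_u_sums:
  assumes \<gamma>: "\<gamma> \<in> Loop1" and z: "cmod z < 1"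
  shows "(\<lambda>n. of_nat (Suc n) * u_coeff n (loop_u \<gamma>) * z ^ n) sums deriv (loop_u \<gamma>) z"
proof -
  have "(\<lambda>n. (deriv ^^ n) (deriv (loop_u \<gamma>)) 0 / fact n * (z - 0) ^ n) sums deriv (loop_u \<gamma>) z"
    by (rule holomorphic_power_series[OF holomorphic_deriv[OF loop_u_holomorphic[OF \<gamma>]]]) (use z in simp_all)
  moreover have "(deriv ^^ n) (deriv (loop_u \<gamma>)) 0 / fact n = of_nat (Suc n) * u_coeff n (loop_u \<gamma>)" for n
  proof -
    have "(deriv ^^ n) (deriv (loop_u \<gamma>)) = (deriv ^^ Suc n) (loop_u \<gamma>)"
      by (simp only: funpow_Suc_right o_apply)
    moreover have "(of_nat (Suc n) :: complex) \<noteq> 0" by (rule of_nat_neq_0)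
    ultimately show ?thesis
      by (simp add: u_coeff_def del: funpow.simps of_nat_Suc)
  qed
  ultimately show ?thesis by (simp only: diff_0_right)
qed

lemma deriv_loop_phi:
  assumes \<gamma>: "\<gamma> \<in> Loop1" and z: "cmod z < 1"
  shows "deriv (loop_phi \<gamma>) z = of_real (loop_rho \<gamma>) * deriv (loop_u \<gamma>) z"
proof -
  have "(loop_u \<gamma> has_field_derivative deriv (loop_u \<gamma>) z) (at z)"
    by (rule holomorphic_derivI[OF loop_u_holomorphic[OF \<gamma>]]) (use z in auto)
  then show ?thesis
    unfolding loop_phi_def[abs_def] by (intro DERIV_imp_deriv DERIV_cmult)
qed

lemma Loop1_nonempty: "\<gamma> \<in> Loop1 \<Longrightarrow> \<gamma> \<noteq> {}"
  by (auto simp: Loop1_iff)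

text \<open>The loop is the frontier of its inside, so |\<open>loop_phi \<gamma>\<close>| =
  \<open>loop_rho \<gamma>\<close> |u| has the same supremum over the disc as the modulus on the
  loop. This recovers the conformal radius from the loop and u; a countable Q makes the formula
  measurable.\<close>

lemma loop_phi_Sup:
  assumes \<gamma>: "\<gamma> \<in> Loop1" and Q: "Q \<subseteq> ball 0 1" "ball 0 1 \<subseteq> closure Q"
  shows "bdd_above ((\<lambda>q. cmod (loop_u \<gamma> q)) ` Q)"
    and "loop_rho \<gamma> = Sup (cmod ` \<gamma>) / (SUP q\<in>Q. cmod (loop_u \<gamma> q))"
proof -
  have hom: "\<gamma> homeomorphic sphere (0::complex) 1" and cpt: "compact \<gamma>" using \<gamma> by (auto simp: Loop1_iff)
  have Qne: "Q \<noteq> {}" using Q by auto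
  define R where "R = Sup (cmod ` \<gamma>)"
  have "bdd_above (cmod ` \<gamma>)"
    by (intro bounded_imp_bdd_above compact_imp_bounded compact_continuous_image continuous_intros cpt)
  then have R: "cmod z \<le> R" if "z \<in> \<gamma>" for z
    unfolding R_def using that by (intro cSup_upper) auto
  have "- cball 0 R \<subseteq> outside \<gamma>"
    by (rule outside_subset_convex) (use R in auto)
  then have insR: "inside \<gamma> \<subseteq> cball 0 R"
    using inside_Int_outside[of \<gamma>] by blast
  note rho = loop_rho_pos[OF \<gamma>]
  have phiR: "loop_rho \<gamma> * cmod (loop_u \<gamma> q) \<le> R" if "q \<in> ball 0 1" for q
  proof -
    have "loop_phi \<gamma> q \<in> inside \<gamma>" using that loop_phi_image[OF \<gamma>] by blast
    then have "cmod (loop_phi \<gamma> q) \<le> R" using insR by auto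
    then show ?thesis using rho by (simp add: loop_phi_def norm_mult)
  qed
  show bdd: "bdd_above ((\<lambda>q. cmod (loop_u \<gamma> q)) ` Q)"
    using phiR Q rho by (intro bdd_aboveI[of _ "R / loop_rho \<gamma>"]) (auto simp: field_simps)
  define S where "S = (SUP q\<in>Q. cmod (loop_u \<gamma> q))"
  have SQ: "cmod (loop_u \<gamma> q) \<le> S" if "q \<in> Q" for q
    unfolding S_def by (rule cSUP_upper[OF that bdd])
  have "S \<le> R / loop_rho \<gamma>"
    unfolding S_def using phiR Q Qne rho by (intro cSUP_least) (auto simp: field_simps)
  then have le: "loop_rho \<gamma> * S \<le> R" using rho by (simp add: field_simps)
  \<comment> \<open>A violation at w is an open condition, so it would also occur at a point of the
    dense set Q.\<close>
  have phiS: "cmod (loop_phi \<gamma> w) \<le> loop_rho \<gamma> * S" if w: "w \<in> ball 0 1" for w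
  proof (rule ccontr)
    assume n: "\<not> ?thesis"
    have "continuous_on (ball 0 1) (loop_phi \<gamma>)"
      using loop_phi_holomorphic[OF \<gamma>] by (rule holomorphic_on_imp_continuous_on)
    then have "open (ball 0 1 \<inter> loop_phi \<gamma> -` (- cball 0 (loop_rho \<gamma> * S)))"
      by (intro continuous_open_preimage) auto
    moreover have "w \<in> ball 0 1 \<inter> loop_phi \<gamma> -` (- cball 0 (loop_rho \<gamma> * S))" using n w by auto
    moreover have "w \<in> closure Q" using w Q by blast
    ultimately obtain q where "q \<in> Q" "loop_phi \<gamma> q \<notin> cball 0 (loop_rho \<gamma> * S)"
      unfolding closure_iff_nhds_not_empty by blast
    then have "loop_rho \<gamma> * S < loop_rho \<gamma> * cmod (loop_u \<gamma> q)"
      using rho by (simp add: loop_phi_def norm_mult)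
    then show False using SQ[OF \<open>q \<in> Q\<close>] rho by simp
  qed
  have "inside \<gamma> \<subseteq> cball 0 (loop_rho \<gamma> * S)"
    unfolding loop_phi_image[OF \<gamma>, symmetric] using phiS by auto
  \<comment> \<open>The bound passes to the closure of the inside, which contains its frontier
    \<gamma>.\<close>
  then have "closure (inside \<gamma>) \<subseteq> cball 0 (loop_rho \<gamma> * S)"
    by (rule closure_minimal) simp
  then have "\<gamma> \<subseteq> cball 0 (loop_rho \<gamma> * S)"
    using homeomorphic_circle_inside(5)[OF hom] by (auto simp: frontier_def)
  then have "R \<le> loop_rho \<gamma> * S"
    unfolding R_def using Loop1_nonempty[OF \<gamma>] by (intro cSUP_least) auto
  then have eq: "R = loop_rho \<gamma> * S" using le by simp
  obtain z where "z \<in> \<gamma>" using Loop1_nonempty[OF \<gamma>] by blast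
  moreover have "0 \<notin> \<gamma>" using \<gamma> by (auto simp: Loop1_iff dest: insideD)
  ultimately have "0 < R" using R[of z] by (metis norm_le_zero_iff not_le order.trans)
  then have "S \<noteq> 0" using eq by auto
  then show "loop_rho \<gamma> = Sup (cmod ` \<gamma>) / (SUP q\<in>Q. cmod (loop_u \<gamma> q))"
    using eq by (simp add: R_def S_def)
qed

text \<open>The image of K is compact, hence closed, so membership is approximability by values on
  the dense set Q. For countable Q this involves only countably many evaluations, each measurable in
  \<gamma>.\<close>

lemma loop_phi_compact_image_iff:
  assumes \<gamma>: "\<gamma> \<in> Loop1" and K: "compact K" "K \<subseteq> ball 0 1" and Q: "Q \<subseteq> K" "K \<subseteq> closure Q"
  shows "x \<in> loop_phi \<gamma> ` K \<longleftrightarrow> (\<forall>m. \<exists>q\<in>Q. cmod (loop_phi \<gamma> q - x) < 1 / real (Suc m))"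
proof
  have cont: "continuous_on K (loop_phi \<gamma>)"
    using loop_phi_holomorphic[OF \<gamma>] K by (intro holomorphic_on_imp_continuous_on) (rule holomorphic_on_subset)
  assume "x \<in> loop_phi \<gamma> ` K"
  then obtain w where w: "w \<in> K" "x = loop_phi \<gamma> w" by blast
  show "\<forall>m. \<exists>q\<in>Q. cmod (loop_phi \<gamma> q - x) < 1 / real (Suc m)"
  proof
    fix m
    obtain d where d: "d > 0" "\<And>v. v \<in> K \<Longrightarrow> dist v w < d \<Longrightarrow> dist (loop_phi \<gamma> v) x < 1 / real (Suc m)"
      using cont w unfolding continuous_on_iff
      by (metis of_nat_0_less_iff zero_less_Suc zero_less_divide_1_iff)
    obtain q where "q \<in> Q" "dist q w < d"
      using Q w d(1) closure_approachable by blast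
    then show "\<exists>q\<in>Q. cmod (loop_phi \<gamma> q - x) < 1 / real (Suc m)"
      using d(2) Q by (auto simp: dist_norm)
  qed
next
  assume *: "\<forall>m. \<exists>q\<in>Q. cmod (loop_phi \<gamma> q - x) < 1 / real (Suc m)"
  have cont: "continuous_on K (loop_phi \<gamma>)"
    using loop_phi_holomorphic[OF \<gamma>] K by (intro holomorphic_on_imp_continuous_on) (rule holomorphic_on_subset)
  have "x \<in> closure (loop_phi \<gamma> ` K)"
    unfolding closure_approachable
  proof (intro allI impI)
    fix e :: real assume "e > 0"
    then obtain m where m: "1 / real (Suc m) < e" using nat_approx_posE by metis
    obtain q where "q \<in> Q" "cmod (loop_phi \<gamma> q - x) < 1 / real (Suc m)" using * by blast
    then show "\<exists>y\<in>loop_phi \<gamma> ` K. dist y x < e"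
      using Q m by (intro bexI[of _ "loop_phi \<gamma> q"]) (auto simp: dist_norm)
  qed
  then show "x \<in> loop_phi \<gamma> ` K"
    using compact_continuous_image[OF cont K(1)] by (simp add: compact_imp_closed closure_closed)
qed

section \<open>Joint measurability of the Riemann map and of the transported mass\<close>

context werner_measure begin

text \<open>The supremum over a compact loop is attained, so it is below y exactly when the loop
  lies in the open ball of radius y, a generator of the Vietoris topology.\<close>

lemma measurable_loop_radius: "(\<lambda>\<gamma>. Sup (cmod ` \<gamma>)) \<in> borel_measurable (\<mu>\<^sub>0 \<mu>)"
proof (rule borel_measurableI_less)
  fix y
  let ?X = "top_of_set (- {0::complex})"
  have "{\<gamma> \<in> space (\<mu>\<^sub>0 \<mu>). Sup (cmod ` \<gamma>) < y} = Loop1 \<inter> {\<gamma> \<in> Loop ?X. \<gamma> \<subseteq> - {0} \<inter> ball 0 y}"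
  proof -
    have "Sup (cmod ` \<gamma>) < y \<longleftrightarrow> \<gamma> \<subseteq> ball 0 y" if \<gamma>: "\<gamma> \<in> Loop1" for \<gamma>
    proof -
      have "compact (cmod ` \<gamma>)" "cmod ` \<gamma> \<noteq> {}"
        using \<gamma> Loop1_nonempty by (auto simp: Loop1_iff intro!: compact_continuous_image continuous_intros)
      then have S: "Sup (cmod ` \<gamma>) \<in> cmod ` \<gamma>" and bdd: "bdd_above (cmod ` \<gamma>)"
        by (auto intro!: closed_contains_Sup bounded_imp_bdd_above compact_imp_bounded compact_imp_closed)
      show ?thesis
      proof
        assume "Sup (cmod ` \<gamma>) < y"
        moreover have "cmod z \<le> Sup (cmod ` \<gamma>)" if "z \<in> \<gamma>" for z
          using that bdd by (intro cSup_upper) auto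
        ultimately show "\<gamma> \<subseteq> ball 0 y" by force
      qed (use S in auto)
    qed
    moreover have "\<gamma> \<in> Loop ?X \<and> \<gamma> \<subseteq> - {0}" if "\<gamma> \<in> Loop1" for \<gamma>
      using that by (auto simp: Loop1_def Loop_top_of_set_iff)
    ultimately show ?thesis by (auto simp: space_mu0)
  qed
  also have "\<dots> \<in> sets (\<mu>\<^sub>0 \<mu>)"
  proof -
    have "openin ?X (- {0} \<inter> ball 0 y)" by (rule openin_open_Int) simp
    then have "{\<gamma> \<in> Loop ?X. \<gamma> \<subseteq> - {0} \<inter> ball 0 y} \<in> sets M"
      unfolding sets_mu[OF punctured_plane] by (intro openin_imp_sets_borel_of openin_vietoris_subset)
    then show ?thesis unfolding \<mu>\<^sub>0_def sets_restrict_space by blast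
  qed
  finally show "{\<gamma> \<in> space (\<mu>\<^sub>0 \<mu>). Sup (cmod ` \<gamma>) < y} \<in> sets (\<mu>\<^sub>0 \<mu>)" .
qed

lemma measurable_loop_rho[measurable]: "loop_rho \<in> borel_measurable (\<mu>\<^sub>0 \<mu>)"
proof -
  obtain Q :: "complex set" where Q: "countable Q" "Q \<subseteq> ball 0 1" "ball 0 1 \<subseteq> closure Q"
    using separable[of "ball 0 1"] by blast
  have [measurable]: "(\<lambda>\<gamma>. SUP q\<in>Q. cmod (loop_u \<gamma> q)) \<in> borel_measurable (\<mu>\<^sub>0 \<mu>)"
    by (rule borel_measurable_cSUP[OF Q(1)]) (use loop_phi_Sup(1)[OF _ Q(2,3)] in \<open>auto simp: space_mu0\<close>)
  have "loop_rho \<in> borel_measurable (\<mu>\<^sub>0 \<mu>) \<longleftrightarrow>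
      (\<lambda>\<gamma>. Sup (cmod ` \<gamma>) / (SUP q\<in>Q. cmod (loop_u \<gamma> q))) \<in> borel_measurable (\<mu>\<^sub>0 \<mu>)"
    by (rule measurable_cong) (use loop_phi_Sup(2)[OF _ Q(2,3)] in \<open>auto simp: space_mu0\<close>)
  then show ?thesis using measurable_loop_radius by simp
qed

lemma measurable_loop_phi_eval[measurable]: "(\<lambda>\<gamma>. loop_phi \<gamma> z) \<in> borel_measurable (\<mu>\<^sub>0 \<mu>)"
  unfolding loop_phi_def by measurable

lemma sets_loop_phi_image:
  assumes K: "compact K" "K \<subseteq> ball 0 1"
  shows "{p \<in> space (\<mu>\<^sub>0 \<mu> \<Otimes>\<^sub>M borel). snd p \<in> loop_phi (fst p) ` K} \<in> sets (\<mu>\<^sub>0 \<mu> \<Otimes>\<^sub>M borel)"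
proof -
  obtain Q where Q: "countable Q" "Q \<subseteq> K" "K \<subseteq> closure Q"
    using separable[of K] by blast
  have "{p \<in> space (\<mu>\<^sub>0 \<mu> \<Otimes>\<^sub>M borel). \<forall>m. \<exists>q\<in>Q. cmod (loop_phi (fst p) q - snd p) < 1 / real (Suc m)}
      \<in> sets (\<mu>\<^sub>0 \<mu> \<Otimes>\<^sub>M borel)"
    using Q(1) by measurable
  also have "{p \<in> space (\<mu>\<^sub>0 \<mu> \<Otimes>\<^sub>M borel). \<forall>m. \<exists>q\<in>Q. cmod (loop_phi (fst p) q - snd p) < 1 / real (Suc m)} =
      {p \<in> space (\<mu>\<^sub>0 \<mu> \<Otimes>\<^sub>M borel). snd p \<in> loop_phi (fst p) ` K}"
    by (intro Collect_cong conj_cong refl loop_phi_compact_image_iff[OF _ K Q(2,3), symmetric])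
      (auto simp: space_pair_measure space_mu0)
  finally show ?thesis .
qed

text \<open>The preimage of a closed set C under the inverse map is the image of the compact set C
  \<inter> \<open>cball 0 r\<close>, handled by \<open>sets_loop_phi_image\<close>. The default 0
  adds the remaining pairs when 0 lies in C.\<close>

lemma measurable_loop_psi:
  assumes r: "r < 1"
  shows "(\<lambda>p. if snd p \<in> loop_phi (fst p) ` cball 0 r then loop_psi (fst p) (snd p) else 0)
    \<in> borel_measurable (\<mu>\<^sub>0 \<mu> \<Otimes>\<^sub>M borel)" (is "?f \<in> borel_measurable ?P")
proof -
  have "?f \<in> ?P \<rightarrow>\<^sub>M sigma UNIV (Collect closed)"
  proof (rule measurable_measure_of)
    fix C :: "complex set" assume "C \<in> Collect closed"
    let ?A = "\<lambda>K. {p \<in> space ?P. snd p \<in> loop_phi (fst p) ` K}"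
    have A: "?A (cball 0 r) \<in> sets ?P" "?A (C \<inter> cball 0 r) \<in> sets ?P"
      using r \<open>C \<in> Collect closed\<close> by (auto intro!: sets_loop_phi_image closed_Int_compact)
    have "?f -` C \<inter> space ?P = ?A (C \<inter> cball 0 r) \<union> (if 0 \<in> C then space ?P - ?A (cball 0 r) else {})"
    proof -
      have "loop_psi (fst p) (snd p) \<in> C \<longleftrightarrow> snd p \<in> loop_phi (fst p) ` (C \<inter> cball 0 r)"
        if p: "p \<in> space ?P" "snd p \<in> loop_phi (fst p) ` cball 0 r" for p
      proof -
        obtain z where z: "z \<in> cball 0 r" "snd p = loop_phi (fst p) z" using p(2) by blast
        have g: "fst p \<in> Loop1" using p(1) by (auto simp: space_pair_measure space_mu0)
        have psi: "loop_psi (fst p) (loop_phi (fst p) w) = w" if "w \<in> cball 0 r" for w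
          by (rule loop_psi_phi[OF g]) (use that r in auto)
        show ?thesis using z psi by (auto simp: image_iff) (metis psi mem_cball_0)
      qed
      moreover have "snd p \<in> loop_phi (fst p) ` cball 0 r" if "snd p \<in> loop_phi (fst p) ` (C \<inter> cball 0 r)" for p
        using that by blast
      ultimately show ?thesis by (auto split: if_splits)
    qed
    then show "?f -` C \<inter> space ?P \<in> sets ?P" using A by simp
  qed auto
  then show ?thesis by (simp only: borel_eq_closed[symmetric])
qed

text \<open>The density at x of the mass that 0 sends, \<open>loop_rho \<gamma>\<close> being the
  conformal radius at 0.\<close>

definition mass_out :: "real \<Rightarrow> complex set \<Rightarrow> complex \<Rightarrow> ennreal" where
  "mass_out r \<gamma> x = (if x \<in> loop_phi \<gamma> ` cball 0 r then ennreal (1 / (loop_rho \<gamma>)\<^sup>2) else 0)"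

text \<open>The density at 0 of the mass sent by x. Symmetry of hyperbolic distance turns the
  condition that 0 lies in the disc about x into the condition on x used here.\<close>

definition mass_in :: "real \<Rightarrow> complex set \<Rightarrow> complex \<Rightarrow> ennreal" where
  "mass_in r \<gamma> x = (if x \<in> loop_phi \<gamma> ` cball 0 r then ennreal (1 / (conformal_radius \<gamma> x)\<^sup>2) else 0)"

lemma measurable_mass_out:
  assumes r: "r < 1"
  shows "(\<lambda>p. mass_out r (fst p) (snd p)) \<in> borel_measurable (\<mu>\<^sub>0 \<mu> \<Otimes>\<^sub>M borel)"
  unfolding mass_out_def
proof (rule measurable_If)
  show "{p \<in> space (\<mu>\<^sub>0 \<mu> \<Otimes>\<^sub>M borel). snd p \<in> loop_phi (fst p) ` cball 0 r} \<in> sets (\<mu>\<^sub>0 \<mu> \<Otimes>\<^sub>M borel)"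
    using r by (intro sets_loop_phi_image) auto
qed measurable

lemma measurable_mass_in:
  assumes r: "r < 1"
  shows "(\<lambda>p. mass_in r (fst p) (snd p)) \<in> borel_measurable (\<mu>\<^sub>0 \<mu> \<Otimes>\<^sub>M borel)"
proof -
  let ?P = "\<mu>\<^sub>0 \<mu> \<Otimes>\<^sub>M (borel :: complex measure)"
  let ?psi = "\<lambda>p. if snd p \<in> loop_phi (fst p) ` cball 0 r then loop_psi (fst p) (snd p) else 0"
  \<comment> \<open>The derivative is taken at a point that varies with the pair. Its power series
    reduces it to the measurable coefficients and powers of the measurable
    \<open>?psi\<close>.\<close>
  define c where "c p = loop_rho (fst p) * cmod (\<Sum>n. of_nat (Suc n) * u_coeff n (loop_u (fst p)) * ?psi p ^ n) *
      (1 - (cmod (?psi p))\<^sup>2)" for p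
  have [measurable]: "?psi \<in> borel_measurable ?P" by (rule measurable_loop_psi[OF r])
  have [measurable]: "c \<in> borel_measurable ?P" unfolding c_def[abs_def] by measurable
  have A: "{p \<in> space ?P. snd p \<in> loop_phi (fst p) ` cball 0 r} \<in> sets ?P"
    using r by (intro sets_loop_phi_image) auto
  have "(\<lambda>p. if snd p \<in> loop_phi (fst p) ` cball 0 r then ennreal (1 / (c p)\<^sup>2) else 0) \<in> borel_measurable ?P"
    by (rule measurable_If[OF _ _ A]) measurable
  moreover have "mass_in r (fst p) (snd p) = (if snd p \<in> loop_phi (fst p) ` cball 0 r then ennreal (1 / (c p)\<^sup>2) else 0)"
    if "p \<in> space ?P" for p
  proof (cases "snd p \<in> loop_phi (fst p) ` cball 0 r")
    case True
    have g: "fst p \<in> Loop1" using that by (auto simp: space_pair_measure space_mu0)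
    obtain z where z: "z \<in> cball 0 r" "snd p = loop_phi (fst p) z" using True by blast
    then have z1: "cmod z < 1" using r by simp
    have "conformal_radius (fst p) (snd p) = c p"
      using True z(2) deriv_loop_phi[OF g z1] sums_unique[OF deriv_loop_u_sums[OF g z1]] loop_psi_phi[OF g z1] loop_rho_pos[OF g]
      by (simp add: conformal_radius_def c_def norm_mult)
    then show ?thesis using True by (simp add: mass_in_def)
  qed (simp add: mass_in_def)
  ultimately show ?thesis
    by (simp cong: measurable_cong)
qed

end

section \<open>Mass transport\<close>

text \<open>Once the coefficients below n vanish, dividing by t^n leaves a series that is zero on
  (0, 1) and continuous at 0, where its value is \<open>d n\<close>.\<close>

lemma powser_coeffs_eq_0:
  fixes d :: "nat \<Rightarrow> real"
  assumes sums0: "\<And>t. 0 < t \<Longrightarrow> t < 1 \<Longrightarrow> (\<lambda>k. d k * t ^ k) sums 0"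
  shows "d n = 0"
proof (induction n rule: less_induct)
  case (less n)
  define f where "f t = (\<Sum>k. d (k + n) * t ^ k)" for t
  have s: "(\<lambda>k. d (k + n) * t ^ k) sums 0" if t: "0 < t" "t < 1" for t
  proof -
    have "(\<Sum>k<n. d k * t ^ k) = 0" using less by simp
    then have "(\<lambda>k. d (k + n) * t ^ (k + n)) sums 0"
      using sums0[OF t] sums_iff_shift[of "\<lambda>k. d k * t ^ k" n 0] by simp
    then have "(\<lambda>k. d (k + n) * t ^ (k + n) / t ^ n) sums (0 / t ^ n)"
      by (rule sums_divide)
    then show ?thesis using t by (simp add: power_add)
  qed
  have "summable (\<lambda>k. d (k + n) * (1 / 2) ^ k)" using s[of "1/2"] by (simp add: sums_iff)
  then have "isCont f 0" unfolding f_def by (rule isCont_powser) simp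
  \<comment> \<open>The double successor starts the sequence at 1/2, strictly inside (0, 1).\<close>
  moreover have "(\<lambda>m. 1 / real (Suc (Suc m))) \<longlonglongrightarrow> 0" by real_asymp
  ultimately have "(\<lambda>m. f (1 / real (Suc (Suc m)))) \<longlonglongrightarrow> f 0"
    by (rule isCont_tendsto_compose)
  moreover have "f (1 / real (Suc (Suc m))) = 0" for m
    using s[of "1 / real (Suc (Suc m))"] by (simp add: f_def sums_iff)
  ultimately have "f 0 = 0" by (simp add: LIMSEQ_const_iff)
  then show ?case by (simp add: f_def powser_zero)
qed

lemma nn_integral_lborel_uminus:
  fixes f :: "'a::euclidean_space \<Rightarrow> ennreal"
  assumes [measurable]: "f \<in> borel_measurable borel"
  shows "(\<integral>\<^sup>+x. f (- x) \<partial>lborel) = (\<integral>\<^sup>+x. f x \<partial>lborel)"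
proof -
  have "lborel = distr lborel borel (\<lambda>x::'a. - x)"
    using lborel_affine[of "-1" "0::'a"] by (simp add: density_1)
  then have "(\<integral>\<^sup>+x. f x \<partial>lborel) = (\<integral>\<^sup>+x. f x \<partial>distr lborel borel (\<lambda>x::'a. - x))" by simp
  also have "\<dots> = (\<integral>\<^sup>+x. f (- x) \<partial>lborel)" by (rule nn_integral_distr) auto
  finally show ?thesis ..
qed

section \<open>The two mass totals and their equality in the mean\<close>

context werner_measure begin

text \<open>The factor \<open>loop_rho \<gamma>\<close>^-2 rescales \<open>loop_phi \<gamma>\<close>
  to u, so this is the area of the image under u of the disc of radius r. In Parseval's identity the
  coefficient (k + 1) u_k is squared and divided by k + 1.\<close>

lemma nn_integral_mass_out:
  assumes \<gamma>: "\<gamma> \<in> Loop1" and r: "0 \<le> r" "r < 1"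
  shows "(\<integral>\<^sup>+x. mass_out r \<gamma> x \<partial>lborel) =
    (\<Sum>k. ennreal (pi * (real k + 1) * r ^ (2 * k + 2)) * ennreal ((cmod (u_coeff k (loop_u \<gamma>)))\<^sup>2))"
proof -
  let ?c = "\<lambda>k. of_nat (Suc k) * u_coeff k (loop_u \<gamma>)"
  have K: "cball 0 r \<subseteq> ball (0::complex) 1" using r by auto
  note rho = loop_rho_pos[OF \<gamma>]
  have "(\<integral>\<^sup>+x. mass_out r \<gamma> x \<partial>lborel) = (\<integral>\<^sup>+x. ennreal (1 / (loop_rho \<gamma>)\<^sup>2) * indicator (loop_phi \<gamma> ` cball 0 r) x \<partial>lborel)"
    by (intro nn_integral_cong) (simp add: mass_out_def indicator_def)
  also have "\<dots> = (\<integral>\<^sup>+z. ennreal (1 / (loop_rho \<gamma>)\<^sup>2) * ennreal ((cmod (deriv (loop_phi \<gamma>) z))\<^sup>2) * indicator (cball 0 r) z \<partial>lborel)"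
    by (rule nn_integral_holomorphic_image[OF compact_cball K open_ball loop_phi_holomorphic[OF \<gamma>]])
      (use inj_on_subset[OF inj_on_loop_phi[OF \<gamma>] K] in simp_all)
  also have "\<dots> = (\<integral>\<^sup>+z. ennreal ((cmod (\<Sum>k. ?c k * z ^ k))\<^sup>2) * indicator (cball 0 r) z \<partial>lborel)"
  proof (rule nn_integral_cong)
    fix z :: complex
    show "ennreal (1 / (loop_rho \<gamma>)\<^sup>2) * ennreal ((cmod (deriv (loop_phi \<gamma>) z))\<^sup>2) * indicator (cball 0 r) z =
        ennreal ((cmod (\<Sum>k. ?c k * z ^ k))\<^sup>2) * indicator (cball 0 r) z"
    proof (cases "z \<in> cball 0 r")
      case True
      then have z: "cmod z < 1" using r by simp
      have "1 / (loop_rho \<gamma>)\<^sup>2 * (cmod (deriv (loop_phi \<gamma>) z))\<^sup>2 = (cmod (deriv (loop_u \<gamma>) z))\<^sup>2"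
        using rho by (simp add: deriv_loop_phi[OF \<gamma> z] norm_mult power_mult_distrib)
      moreover have "(\<Sum>k. ?c k * z ^ k) = deriv (loop_u \<gamma>) z"
        by (rule sums_unique[OF deriv_loop_u_sums[OF \<gamma> z], symmetric])
      ultimately show ?thesis by (simp only: flip: ennreal_mult'[OF divide_nonneg_nonneg[OF zero_le_one zero_le_power2]])
    qed simp
  qed
  also have "\<dots> = (\<Sum>k. ennreal (pi * (cmod (?c k))\<^sup>2 * r ^ (2 * k + 2) / (real k + 1)))"
  proof (rule nn_integral_power_series_cball[OF r(1)])
    \<comment> \<open>The midpoint of r and 1 is a point of convergence of larger modulus than r,
      which gives absolute convergence at r.\<close>
    have "cmod (of_real ((1 + r) / 2)) < 1"
      unfolding norm_of_real using r by simp
    then have "summable (\<lambda>k. ?c k * (of_real ((1 + r) / 2)) ^ k)"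
      by (rule sums_summable[OF deriv_loop_u_sums[OF \<gamma>]])
    moreover have "cmod (of_real r) < cmod (of_real ((1 + r) / 2))"
      unfolding norm_of_real using r by simp
    ultimately have "summable (\<lambda>k. norm (?c k * (of_real r) ^ k))"
      by (rule powser_insidea)
    then show "summable (\<lambda>k. norm (?c k) * r ^ k)"
      using r by (simp add: norm_mult norm_power)
  qed
  also have "\<dots> = (\<Sum>k. ennreal (pi * (real k + 1) * r ^ (2 * k + 2)) * ennreal ((cmod (u_coeff k (loop_u \<gamma>)))\<^sup>2))"
  proof (rule suminf_cong)
    fix k
    have "cmod (?c k) = (real k + 1) * cmod (u_coeff k (loop_u \<gamma>))"
      by (simp only: norm_mult norm_of_nat) simp
    then have "pi * (cmod (?c k))\<^sup>2 * r ^ (2 * k + 2) / (real k + 1) =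
        (pi * (real k + 1) * r ^ (2 * k + 2)) * (cmod (u_coeff k (loop_u \<gamma>)))\<^sup>2"
      by (simp only: power_mult_distrib power2_eq_square) (simp add: field_simps)
    then show "ennreal (pi * (cmod (?c k))\<^sup>2 * r ^ (2 * k + 2) / (real k + 1)) =
        ennreal (pi * (real k + 1) * r ^ (2 * k + 2)) * ennreal ((cmod (u_coeff k (loop_u \<gamma>)))\<^sup>2)"
      using r by (simp only: ennreal_mult'' zero_le_power2)
  qed
  finally show ?thesis .
qed

text \<open>In the disc coordinate the Jacobian cancels the derivative inside the conformal radius
  and leaves the hyperbolic density, whatever the loop.\<close>

lemma nn_integral_mass_in:
  assumes \<gamma>: "\<gamma> \<in> Loop1" and r: "0 \<le> r" "r < 1"
  shows "(\<integral>\<^sup>+x. mass_in r \<gamma> x \<partial>lborel) = ennreal (pi * r\<^sup>2 / (1 - r\<^sup>2))"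
proof -
  have K: "cball 0 r \<subseteq> ball (0::complex) 1" using r by auto
  have meas: "mass_in r \<gamma> \<in> borel_measurable borel"
    using measurable_compose[OF measurable_Pair1' measurable_mass_in[OF r(2)], of \<gamma>] \<gamma> by (simp add: space_mu0)
  have "(\<integral>\<^sup>+x. mass_in r \<gamma> x \<partial>lborel) = (\<integral>\<^sup>+x. mass_in r \<gamma> x * indicator (loop_phi \<gamma> ` cball 0 r) x \<partial>lborel)"
    by (intro nn_integral_cong) (simp add: mass_in_def indicator_def)
  also have "\<dots> = (\<integral>\<^sup>+z. mass_in r \<gamma> (loop_phi \<gamma> z) * ennreal ((cmod (deriv (loop_phi \<gamma>) z))\<^sup>2) * indicator (cball 0 r) z \<partial>lborel)"
    by (rule nn_integral_holomorphic_image[OF compact_cball K open_ball loop_phi_holomorphic[OF \<gamma>]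
          inj_on_subset[OF inj_on_loop_phi[OF \<gamma>] K] meas])
  also have "\<dots> = (\<integral>\<^sup>+z. ennreal (1 / (1 - (cmod z)\<^sup>2)\<^sup>2) * indicator (cball 0 r) z \<partial>lborel)"
  proof (rule nn_integral_cong)
    fix z :: complex
    show "mass_in r \<gamma> (loop_phi \<gamma> z) * ennreal ((cmod (deriv (loop_phi \<gamma>) z))\<^sup>2) * indicator (cball 0 r) z =
        ennreal (1 / (1 - (cmod z)\<^sup>2)\<^sup>2) * indicator (cball 0 r) z"
    proof (cases "z \<in> cball 0 r")
      case True
      then have z: "cmod z < 1" using r by simp
      have "deriv (loop_phi \<gamma>) z \<noteq> 0"
        by (rule holomorphic_injective_imp_regular[OF loop_phi_holomorphic[OF \<gamma>] open_ball inj_on_loop_phi[OF \<gamma>]])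
          (use z in simp)
      then have "1 / (conformal_radius \<gamma> (loop_phi \<gamma> z))\<^sup>2 * (cmod (deriv (loop_phi \<gamma>) z))\<^sup>2 = 1 / (1 - (cmod z)\<^sup>2)\<^sup>2"
        by (simp add: conformal_radius_def loop_psi_phi[OF \<gamma> z] power_mult_distrib)
      moreover have "loop_phi \<gamma> z \<in> loop_phi \<gamma> ` cball 0 r" using True by blast
      ultimately show ?thesis by (simp add: mass_in_def flip: ennreal_mult')
    qed simp
  qed
  also have "\<dots> = ennreal (pi * r\<^sup>2 / (1 - r\<^sup>2))"
    by (rule nn_integral_cball_hyperbolic[OF r])
  finally show ?thesis .
qed

text \<open>Moving d to 0 turns what 0 sends to d into what -d sends to 0. The indicators are kept
  because the translate may fail to surround 0.\<close>

lemma mass_out_eq_mass_in_translation: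
  assumes r: "r < 1"
  shows "mass_out r \<gamma> d * indicator Loop1 \<gamma> =
    mass_in r ((\<lambda>z. z - d) ` \<gamma>) (- d) * indicator Loop1 ((\<lambda>z. z - d) ` \<gamma>)"
proof (cases "\<gamma> \<in> Loop1 \<and> d \<in> loop_phi \<gamma> ` cball 0 r")
  case True
  then show ?thesis
    using rebase_loop[of \<gamma> r d] r by (simp add: mass_out_def mass_in_def)
next
  case False
  let ?g = "(\<lambda>z. z - d) ` \<gamma>"
  have "\<not> (?g \<in> Loop1 \<and> - d \<in> loop_phi ?g ` cball 0 r)"
    \<comment> \<open>Rebasing the translate at -d returns to \<gamma>, so the support conditions on
      the two sides are equivalent.\<close>
    using rebase_loop(1,2)[of ?g r "- d"] r False by (auto simp: image_image)
  then show ?thesis using False by (auto simp: mass_out_def mass_in_def indicator_def)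
qed

text \<open>Passes to \<open>M\<close>, the measure of the once punctured plane, to which conformal
  restriction applies directly.\<close>

lemma nn_integral_trunc:
  assumes [measurable]: "f \<in> borel_measurable (\<mu>\<^sub>0 \<mu>)"
  shows "(\<integral>\<^sup>+\<gamma>. f \<gamma> \<partial>trunc) = (\<integral>\<^sup>+\<gamma>. cutoff \<gamma> * f \<gamma> * indicator Loop1 \<gamma> \<partial>M)"
    and "(\<lambda>\<gamma>. cutoff \<gamma> * f \<gamma> * indicator Loop1 \<gamma>) \<in> borel_measurable M"
proof -
  have L: "Loop1 \<inter> space M \<in> sets M" using sets_Loop1 by auto
  have "(\<integral>\<^sup>+\<gamma>. f \<gamma> \<partial>trunc) = (\<integral>\<^sup>+\<gamma>. cutoff \<gamma> * f \<gamma> \<partial>\<mu>\<^sub>0 \<mu>)"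
    unfolding trunc_def by (rule nn_integral_density) auto
  then show "(\<integral>\<^sup>+\<gamma>. f \<gamma> \<partial>trunc) = (\<integral>\<^sup>+\<gamma>. cutoff \<gamma> * f \<gamma> * indicator Loop1 \<gamma> \<partial>M)"
    using nn_integral_restrict_space[OF L, of "\<lambda>\<gamma>. cutoff \<gamma> * f \<gamma>"] by (simp add: \<mu>\<^sub>0_def)
  have "(\<lambda>\<gamma>. cutoff \<gamma> * f \<gamma>) \<in> borel_measurable (restrict_space M Loop1)"
    unfolding \<mu>\<^sub>0_def[symmetric] by measurable
  then show "(\<lambda>\<gamma>. cutoff \<gamma> * f \<gamma> * indicator Loop1 \<gamma>) \<in> borel_measurable M"
    by (simp only: borel_measurable_restrict_space_iff_ennreal[OF L])
qed

text \<open>Conformal restriction enters here: the plane punctured at \<open>0\<close> and \<open>d\<close> embeds into the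
  once punctured plane both by inclusion and by the translation moving \<open>d\<close> to \<open>0\<close>.\<close>

lemma nn_integral_mass_out_eq_mass_in:
  assumes r: "r < 1"
  shows "(\<integral>\<^sup>+\<gamma>. mass_out r \<gamma> d \<partial>trunc) = (\<integral>\<^sup>+\<gamma>. mass_in r \<gamma> (- d) \<partial>trunc)"
proof -
  have mF: "(\<lambda>\<gamma>. mass_out r \<gamma> x) \<in> borel_measurable (\<mu>\<^sub>0 \<mu>)" "(\<lambda>\<gamma>. mass_in r \<gamma> x) \<in> borel_measurable (\<mu>\<^sub>0 \<mu>)" for x
    using measurable_compose[OF measurable_Pair2' measurable_mass_out[OF r], of x]
      measurable_compose[OF measurable_Pair2' measurable_mass_in[OF r], of x] by simp_all
  define H1 where "H1 \<gamma> = cutoff \<gamma> * mass_out r \<gamma> d * indicator Loop1 \<gamma>" for \<gamma>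
  define H2 where "H2 \<gamma> = cutoff \<gamma> * mass_in r \<gamma> (- d) * indicator Loop1 \<gamma>" for \<gamma>
  have mH: "H1 \<in> borel_measurable M" "H2 \<in> borel_measurable M"
    unfolding H1_def[abs_def] H2_def[abs_def] by (intro nn_integral_trunc(2) mF)+
  \<comment> \<open>Wherever one of the transported masses is nonzero, the loop avoids both
    punctures, so restricting to the loops of the twice punctured plane loses nothing.\<close>
  have inside: "x \<notin> \<gamma> \<and> 0 \<notin> \<gamma>" if "\<gamma> \<in> Loop1" "x \<in> loop_phi \<gamma> ` cball 0 r" for \<gamma> x
  proof -
    have "x \<in> inside \<gamma>" using that r loop_phi_image[OF that(1)] by auto
    then show ?thesis using that(1) by (auto simp: Loop1_iff dest: insideD)
  qed
  \<comment> \<open>Writing the inclusion as translation by 0 lets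
    \<open>nn_integral_translation\<close> treat both embeddings.\<close>
  have i1: "H1 \<gamma> * indicator {\<gamma>. \<gamma> \<subseteq> (\<lambda>z. z - 0) ` (- {0, d})} \<gamma> = H1 \<gamma>" for \<gamma>
    using inside[of \<gamma> d] by (auto simp: H1_def mass_out_def indicator_def)
  have "x \<in> (\<lambda>z. z - d) ` (- {0, d})" if "x \<noteq> - d" "x \<noteq> 0" for x
    by (rule image_eqI[of _ _ "x + d"]) (use that in \<open>auto simp: eq_neg_iff_add_eq_0\<close>)
  then have "(\<lambda>z. z - d) ` (- {0, d}) = - {- d, 0}" by auto
  then have i2: "H2 \<gamma> * indicator {\<gamma>. \<gamma> \<subseteq> (\<lambda>z. z - d) ` (- {0, d})} \<gamma> = H2 \<gamma>" for \<gamma>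
    using inside[of \<gamma> "- d"] by (auto simp: H2_def mass_in_def indicator_def)
  have "(\<integral>\<^sup>+\<gamma>. mass_out r \<gamma> d \<partial>trunc) = (\<integral>\<^sup>+\<gamma>. H1 \<gamma> \<partial>M)"
    unfolding H1_def by (rule nn_integral_trunc(1)[OF mF(1)])
  also have "\<dots> = (\<integral>\<^sup>+\<gamma>. H1 ((\<lambda>z. z - 0) ` \<gamma>) \<partial>\<mu> (plane_surface (- {0, d})))"
    by (subst nn_integral_translation[OF twice_punctured_plane punctured_plane _ mH(1)]) (auto simp only: i1, simp)
  also have "\<dots> = (\<integral>\<^sup>+\<gamma>. H2 ((\<lambda>z. z - d) ` \<gamma>) \<partial>\<mu> (plane_surface (- {0, d})))"
    using mass_out_eq_mass_in_translation[OF r, of _ d]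
    by (intro nn_integral_cong) (simp add: H1_def H2_def cutoff_translation mult.assoc)
  also have "\<dots> = (\<integral>\<^sup>+\<gamma>. H2 \<gamma> \<partial>M)"
    by (subst nn_integral_translation[OF twice_punctured_plane punctured_plane _ mH(2)]) (auto simp only: i2, simp)
  also have "\<dots> = (\<integral>\<^sup>+\<gamma>. mass_in r \<gamma> (- d) \<partial>trunc)"
    unfolding H2_def by (rule nn_integral_trunc(1)[OF mF(2), symmetric])
  finally show ?thesis .
qed

text \<open>Both densities are integrated over all x. Fubini is applied to the probability measure
  \<open>trunc\<close>, the equality of means holds for each x up to the sign of x, and reflection
  of the plane removes the sign.\<close>

lemma sum_second_moments:
  assumes r: "0 \<le> r" "r < 1"
  shows "(\<Sum>k. ennreal (pi * (real k + 1) * r ^ (2 * k + 2)) * (\<integral>\<^sup>+u. ennreal ((cmod (u_coeff k u))\<^sup>2) \<partial>\<nu>)) =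
    ennreal (pi * r\<^sup>2 / (1 - r\<^sup>2))"
proof -
  interpret trunc: prob_space trunc by (rule prob_space_trunc)
  interpret P: pair_sigma_finite trunc "lborel :: complex measure" ..
  have mF[measurable]: "(\<lambda>(\<gamma>, x). mass_out r \<gamma> x) \<in> borel_measurable (trunc \<Otimes>\<^sub>M (lborel :: complex measure))"
     "(\<lambda>(\<gamma>, x). mass_in r \<gamma> x) \<in> borel_measurable (trunc \<Otimes>\<^sub>M (lborel :: complex measure))"
    using measurable_mass_out[OF r(2)] measurable_mass_in[OF r(2)]
    by (simp_all add: case_prod_beta cong: measurable_cong_sets sets_pair_measure_cong)
  have "(\<Sum>k. ennreal (pi * (real k + 1) * r ^ (2 * k + 2)) * (\<integral>\<^sup>+u. ennreal ((cmod (u_coeff k u))\<^sup>2) \<partial>\<nu>)) =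
     (\<Sum>k. \<integral>\<^sup>+\<gamma>. ennreal (pi * (real k + 1) * r ^ (2 * k + 2)) * ennreal ((cmod (u_coeff k (loop_u \<gamma>)))\<^sup>2) \<partial>trunc)"
    by (intro suminf_cong, subst nn_integral_trunc_u[symmetric]) (auto intro!: nn_integral_cmult[symmetric])
  also have "\<dots> = (\<integral>\<^sup>+\<gamma>. (\<Sum>k. ennreal (pi * (real k + 1) * r ^ (2 * k + 2)) * ennreal ((cmod (u_coeff k (loop_u \<gamma>)))\<^sup>2)) \<partial>trunc)"
    by (rule nn_integral_suminf[symmetric]) measurable
  also have "\<dots> = (\<integral>\<^sup>+\<gamma>. (\<integral>\<^sup>+x. mass_out r \<gamma> x \<partial>lborel) \<partial>trunc)"
    by (intro nn_integral_cong) (simp add: nn_integral_mass_out[OF _ r] space_trunc)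
  also have "\<dots> = (\<integral>\<^sup>+x. (\<integral>\<^sup>+\<gamma>. mass_out r \<gamma> x \<partial>trunc) \<partial>lborel)"
    by (rule P.Fubini'[symmetric]) (rule mF)
  also have "\<dots> = (\<integral>\<^sup>+x. (\<integral>\<^sup>+\<gamma>. mass_in r \<gamma> (- x) \<partial>trunc) \<partial>lborel)"
    by (simp only: nn_integral_mass_out_eq_mass_in[OF r(2)])
  also have "\<dots> = (\<integral>\<^sup>+x. (\<integral>\<^sup>+\<gamma>. mass_in r \<gamma> x \<partial>trunc) \<partial>lborel)"
  proof (rule nn_integral_lborel_uminus)
    have "(\<lambda>x. \<integral>\<^sup>+\<gamma>. mass_in r \<gamma> x \<partial>trunc) \<in> borel_measurable (lborel :: complex measure)"
      using measurable_compose[OF measurable_pair_swap' mF(2)]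
      by (intro trunc.borel_measurable_nn_integral) (simp add: case_prod_beta)
    then show "(\<lambda>x. \<integral>\<^sup>+\<gamma>. mass_in r \<gamma> x \<partial>trunc) \<in> borel_measurable borel" by simp
  qed
  also have "\<dots> = (\<integral>\<^sup>+\<gamma>. (\<integral>\<^sup>+x. mass_in r \<gamma> x \<partial>lborel) \<partial>trunc)"
    by (rule P.Fubini') (rule mF)
  also have "\<dots> = (\<integral>\<^sup>+\<gamma>. ennreal (pi * r\<^sup>2 / (1 - r\<^sup>2)) \<partial>trunc)"
    by (intro nn_integral_cong) (simp add: nn_integral_mass_in[OF _ r] space_trunc)
  also have "\<dots> = ennreal (pi * r\<^sup>2 / (1 - r\<^sup>2))"
    by (simp add: trunc.emeasure_space_1)
  finally show ?thesis .
qed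

lemma second_moment: "(\<integral>\<^sup>+u. ennreal ((cmod (u_coeff n u))\<^sup>2) \<partial>\<nu>) = ennreal (1 / (real n + 1))"
proof -
  define E where "E k = (\<integral>\<^sup>+u. ennreal ((cmod (u_coeff k u))\<^sup>2) \<partial>\<nu>)" for k
  define w where "w k r = pi * (real k + 1) * r ^ (2 * k + 2)" for k and r :: real
  have w: "0 \<le> w k r" if "0 \<le> r" for k r using that by (simp add: w_def)
  have sum_E: "(\<Sum>k. ennreal (w k r) * E k) = ennreal (pi * r\<^sup>2 / (1 - r\<^sup>2))" if "0 \<le> r" "r < 1" for r
    using sum_second_moments[OF that] by (simp add: E_def w_def)
  have fin: "E k \<noteq> top" for k
  proof
    assume "E k = top"
    \<comment> \<open>A single term is bounded by the finite total; any radius strictly between 0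
      and 1 would serve.\<close>
    have "0 < w k (1/2)" by (simp add: w_def)
    then have "ennreal (w k (1/2)) * E k = top" using \<open>E k = top\<close> by (simp add: ennreal_mult_top)
    moreover have "ennreal (w k (1/2)) * E k \<le> (\<Sum>k. ennreal (w k (1/2)) * E k)"
      using sum_le_suminf[of "\<lambda>k. ennreal (w k (1/2)) * E k" "{k}"] by simp
    ultimately show False using sum_E[of "1/2"] by (simp add: top_unique)
  qed
  define e where "e k = enn2real (E k)" for k
  have E: "E k = ennreal (e k)" and e0: "0 \<le> e k" for k
    using fin[of k] by (simp_all add: e_def less_top)
  \<comment> \<open>With t = r^2, the identity divided by pi t reads: the sum of (k + 1) e_k t^k is
    1/(1 - t). Subtracting the geometric series leaves 0.\<close>
  have "(\<lambda>k. ((real k + 1) * e k - 1) * t ^ k) sums 0" if t: "0 < t" "t < 1" for t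
  proof -
    define r where "r = sqrt t"
    have r: "0 < r" "r < 1" "r\<^sup>2 = t" using t by (auto simp: r_def)
    have eq: "(\<Sum>k. ennreal (w k r * e k)) = ennreal (pi * t / (1 - t))"
      using sum_E[of r] r w by (simp add: E ennreal_mult e0)
    have nn: "0 \<le> w k r * e k" for k using w[of r k] r e0 by simp
    have sm: "summable (\<lambda>k. w k r * e k)"
      by (rule summable_suminf_not_top[OF nn]) (simp add: eq)
    have "0 \<le> pi * t / (1 - t)" using t by simp
    then have "(\<Sum>k. w k r * e k) = pi * t / (1 - t)"
      using eq suminf_ennreal2[OF nn sm] suminf_nonneg[OF sm nn] by simp
    then have "(\<lambda>k. w k r * e k) sums (pi * t / (1 - t))"
      using sm by (simp add: sums_iff)
    then have "(\<lambda>k. w k r * e k / (pi * t)) sums (pi * t / (1 - t) / (pi * t))"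
      by (rule sums_divide)
    moreover have "w k r * e k / (pi * t) = (real k + 1) * e k * t ^ k" for k
    proof -
      have "2 * k + 2 = 2 * (k + 1)" by simp
      then have "r ^ (2 * k + 2) = (r\<^sup>2) ^ (k + 1)" by (simp only: power_mult)
      then have "w k r = pi * (real k + 1) * (t ^ k * t)" by (simp add: w_def r(3))
      then show ?thesis using t by simp
    qed
    moreover have "pi * t / (1 - t) / (pi * t) = 1 / (1 - t)" using t by simp
    ultimately have "(\<lambda>k. (real k + 1) * e k * t ^ k) sums (1 / (1 - t))" by simp
    from sums_diff[OF this geometric_sums[of t]] show ?thesis
      using t by (simp add: left_diff_distrib)
  qed
  from powser_coeffs_eq_0[OF this] have "(real n + 1) * e n - 1 = 0" .
  then have "e n = 1 / (real n + 1)" by (simp add: field_simps)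
  then show ?thesis using E[of n] by (simp add: E_def)
qed

end

theorem theorem1p7:
  fixes \<mu> :: "complex surface \<Rightarrow> complex set measure"
    and \<nu>\<^sub>0 :: "(complex \<Rightarrow> complex) measure"
    and n :: nat
  assumes "werner_family \<mu>"
    and "is_\<nu>\<^sub>0 \<mu> \<nu>\<^sub>0"
    and "prob_space \<nu>\<^sub>0"
    and "n \<ge> 1"
  shows "(\<integral>u. (cmod (u_coeff n u))\<^sup>2 \<partial>\<nu>\<^sub>0) = 1 / (real n + 1)"
proof -
  interpret werner_measure \<mu> \<nu>\<^sub>0
    by (rule werner_measure.intro) (use assms in \<open>simp_all only: werner_family_def\<close>)
  have "(\<integral>u. (cmod (u_coeff n u))\<^sup>2 \<partial>\<nu>\<^sub>0) = enn2real (\<integral>\<^sup>+u. ennreal ((cmod (u_coeff n u))\<^sup>2) \<partial>\<nu>\<^sub>0)"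
    by (rule integral_eq_nn_integral) auto
  then show ?thesis by (simp add: second_moment)
qed

end
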